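(* Fix $A \in \mathbb{Z}^{d\times n}$ and $b \in \mathbb{C}^n$. Let $\beta = (e^{-i b_1 \pi/2},\dots,e^{-i b_n\pi/2}) \in (\mathbb{C}^* )^n$ and let $Y_{A,\beta} \subseteq \mathbb{C}^n$ be the corresponding scaled affine toric variety. If $g_1,\dots,g_r$ generate the ideal of $Y_{A,\beta} \cap (\mathbb{C}^* )^n$ in $\mathbb{C}[y_1^{\pm1},\dots,y_n^{\pm1}]$, then $$\mathcal{L}_{A,b} = \{x \in \mathbb{C}^n : \operatorname{rank}(M_{g_1} | \cdots | M_{g_r}) < 2^n\},$$ where $(M_{g_1}|\cdots|M_{g_r})$ is the $2^n \times (r\,2^n)$ matrix obtained by concatenating the $2^n\times 2^n$ matrices $M_{g_k}$ with entries in $\mathbb{C}[x_1,\dots,x_n]$ (defined in the context), and the rank is that of its evaluation at the point $x$.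
   Context: For $A \in \mathbb{Z}^{d\times n}$ with columns $a_1,\dots,a_n$ and $b \in \mathbb{C}^n$, the Lissajous variety $\mathcal{L}_{A,b}\subseteq\mathbb{C}^n$ is the image of $\operatorname{Row}(A) - \frac{\pi}{2}b$ under the coordinate-wise cosine map $\mathbb{C}^n\to\mathbb{C}^n$, where $\operatorname{Row}(A)\subseteq \mathbb{C}^n$ is the $\mathbb{C}$-span of the rows of $A$. $Y_A \subseteq \mathbb{C}^n$ is the Zariski closure of the image of $(\mathbb{C}^* )^d\to\mathbb{C}^n$, $v \mapsto (v^{a_1},\dots,v^{a_n})$, with $v^{a_j}=\prod_k v_k^{a_{kj}}$, and $Y_{A,\beta} = \{(\beta_1y_1,\dots,\beta_ny_n) : y \in Y_A\}$. Multiplication matrices: let $K = \overline{\mathbb{C}(x_1,\dots,x_n)}$, $f_j = 2x_j - y_j - y_j^{-1}$ and $\mathcal{A} = K[y_1^{\pm1},\dots,y_n^{\pm1}]/\langle f_1,\dots,f_n\rangle \simeq \bigotimes_{j=1}^n K[y_j^{\pm1}]/\langle f_j\rangle$, a $K$-vector space of dimension $2^n$. For $g\in K[y_1^{\pm 1},\dots,y_n^{\pm1}]$, $M_g$ is the matrix of the multiplication map $\mathcal{A}\to\mathcal{A}$, $[h] \mapsto [gh]$, in the tensor product basis built from the bases $\{[1],[y_j]\}$ of $K[y_j^{\pm1}]/\langle f_j\rangle$. Explicitly, $M_{y_j} = \mathrm{id}_2 \otimes\cdots\otimes \begin{pmatrix} 0 & -1\\ 1 & 2x_j\end{pmatrix}\otimes\cdots\otimes\mathrm{id}_2$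 (Kronecker product of $n$ factors, the displayed matrix in position $j$). These matrices commute pairwise and are invertible over $\mathbb{C}[x_1,\dots,x_n]$, and $M_g = g(M_{y_1},\dots,M_{y_n})$; thus $M_g$ has entries in $\mathbb{C}[x_1,\dots,x_n]$ for $g \in \mathbb{C}[y_1^{\pm1},\dots,y_n^{\pm1}]$. *)

theory Defs
  imports
    "HOL-Analysis.Analysis"
    "HOL-Library.Poly_Mapping"
    "HOL-Computational_Algebra.Fraction_Field"
    "HOL-Algebra.Algebraic_Closure_Type"
begin

text \<open>
  The variables are indexed by a finite linearly ordered type \<open>'n\<close>, in the role of
  \<open>{1, \<dots>, n}\<close>.  The order makes the exponent monoid \<open>'n \<Rightarrow>\<^sub>0 nat\<close> linearly ordered, which is
  what the library needs to recognise the polynomial ring as an integral domain.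
\<close>

type_synonym ('n, 'k) mpoly = "('n \<Rightarrow>\<^sub>0 nat) \<Rightarrow>\<^sub>0 'k"
type_synonym ('n, 'k) laurent = "('n \<Rightarrow>\<^sub>0 int) \<Rightarrow>\<^sub>0 'k"

definition poly_eval :: "('n::finite, 'k::field) mpoly \<Rightarrow> 'k^'n \<Rightarrow> 'k" where
  "poly_eval p y = (\<Sum>m\<in>Poly_Mapping.keys p.
     Poly_Mapping.lookup p m * (\<Prod>j\<in>UNIV. (y $ j) ^ Poly_Mapping.lookup m j))"

definition laurent_eval :: "('n::finite, 'k::field) laurent \<Rightarrow> 'k^'n \<Rightarrow> 'k" where
  "laurent_eval g y = (\<Sum>m\<in>Poly_Mapping.keys g.
     Poly_Mapping.lookup g m * (\<Prod>j\<in>UNIV. (y $ j) powi Poly_Mapping.lookup m j))"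

definition torus :: "('k::field^'n) set" where
  "torus = {v. \<forall>j. v $ j \<noteq> 0}"

definition zariski_closure :: "('k::field^'n::finite) set \<Rightarrow> ('k^'n) set" where
  "zariski_closure S =
     {y. \<forall>p :: ('n, 'k) mpoly. (\<forall>s\<in>S. poly_eval p s = 0) \<longrightarrow> poly_eval p y = 0}"

text \<open>The ideal of \<open>S\<close> in the Laurent polynomial ring, for \<open>S\<close> a subset of the torus.\<close>

definition laurent_ideal :: "('k::field^'n::finite) set \<Rightarrow> ('n, 'k) laurent set" where
  "laurent_ideal S = {g. \<forall>y\<in>S. laurent_eval g y = 0}"

abbreviation ideal_generated_by :: "'a::comm_ring_1 set \<Rightarrow> 'a set" where
  "ideal_generated_by B \<equiv> Modules.module.span (*) B"

definition monomial_map :: "int^'n^'d::finite \<Rightarrow> complex^'d \<Rightarrow> complex^'n::finite" where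
  "monomial_map A v = (\<chi> j. \<Prod>k\<in>UNIV. (v $ k) powi (A $ k $ j))"

definition affine_toric :: "int^'n^'d::finite \<Rightarrow> (complex^'n::finite) set" where
  "affine_toric A = zariski_closure (monomial_map A ` torus)"

definition scaled_toric :: "int^'n^'d::finite \<Rightarrow> complex^'n \<Rightarrow> (complex^'n::finite) set" where
  "scaled_toric A \<beta> = (\<lambda>y. \<chi> j. \<beta> $ j * y $ j) ` affine_toric A"

definition row_space :: "int^'n^'d::finite \<Rightarrow> (complex^'n::finite) set" where
  "row_space A = vec.span (rows (map_matrix complex_of_int A))"

definition lissajous :: "int^'n^'d::finite \<Rightarrow> complex^'n \<Rightarrow> (complex^'n::finite) set" where
  "lissajous A b =
     (\<lambda>u. \<chi> j. cos (u $ j)) ` ((\<lambda>u. u - (complex_of_real pi / 2) *s b) ` row_space A)"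

text \<open>The field \<open>K\<close>, the algebraic closure of \<open>\<complex>(x\<^sub>1, \<dots>, x\<^sub>n)\<close>.\<close>

type_synonym 'n ratfun_closure = "('n, complex) mpoly fract alg_closure"

definition of_poly :: "('n::{finite,linorder}, complex) mpoly \<Rightarrow> 'n ratfun_closure" where
  "of_poly p = to_ac (Fract p 1)"

definition xvar :: "'n \<Rightarrow> ('n::{finite,linorder}, complex) mpoly" where
  "xvar j = Poly_Mapping.single (Poly_Mapping.single j 1) 1"

definition yvar_power :: "'n \<Rightarrow> int \<Rightarrow> ('n::finite, 'k::field) laurent" where
  "yvar_power j k = Poly_Mapping.single (Poly_Mapping.single j k) 1"

definition scalar :: "'k \<Rightarrow> ('n::finite, 'k::field) laurent" where
  "scalar c = Poly_Mapping.single 0 c"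

definition f_rel :: "'n \<Rightarrow> ('n::{finite,linorder}, 'n ratfun_closure) laurent" where
  "f_rel j = scalar (of_poly (2 * xvar j)) - yvar_power j 1 - yvar_power j (-1)"

definition rel_ideal :: "('n::{finite,linorder}, 'n ratfun_closure) laurent set" where
  "rel_ideal = ideal_generated_by (Set.range f_rel)"

text \<open>
  The tensor product basis of \<open>\<A> = K[y\<^sup>\<plusminus>\<^sup>1]/\<langle>f\<^sub>1, \<dots>, f\<^sub>n\<rangle>\<close> consists of the classes of the squarefree
  monomials \<open>\<Prod>j\<in>S. y\<^sub>j\<close>.  It is indexed by the subsets \<open>S\<close> of the set of variables, the
  factor in position \<open>j\<close> being \<open>[y\<^sub>j]\<close> if \<open>j \<in> S\<close> and \<open>[1]\<close> otherwise.
\<close>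

definition basis_mon :: "'n set \<Rightarrow> ('n::finite, 'k::field) laurent" where
  "basis_mon S = (\<Prod>j\<in>S. yvar_power j 1)"

text \<open>
  The matrix of \<open>[h] \<mapsto> [g h]\<close> on \<open>\<A>\<close>: column \<open>S\<close> holds the coordinates of
  \<open>[g \<Prod>j\<in>S. y\<^sub>j]\<close>.  Equality in \<open>\<A>\<close> is congruence modulo \<^const>\<open>rel_ideal\<close>.
\<close>

definition is_mult_matrix ::
  "('n::{finite,linorder}, 'n ratfun_closure) laurent
    \<Rightarrow> 'n ratfun_closure^('n set)^('n set) \<Rightarrow> bool" where
  "is_mult_matrix g M \<longleftrightarrow>
     (\<forall>S. g * basis_mon S - (\<Sum>T\<in>UNIV. scalar (M $ T $ S) * basis_mon T) \<in> rel_ideal)"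

definition mult_matrix ::
  "('n::{finite,linorder}, 'n ratfun_closure) laurent
    \<Rightarrow> 'n ratfun_closure^('n set)^('n set)" where
  "mult_matrix g = (THE M. is_mult_matrix g M)"

definition extend_scalars ::
  "('n::{finite,linorder}, complex) laurent \<Rightarrow> ('n, 'n ratfun_closure) laurent" where
  "extend_scalars g = Poly_Mapping.map (\<lambda>c. of_poly (Poly_Mapping.single 0 c)) g"

text \<open>
  For \<open>g\<close> with complex coefficients the entries of \<^const>\<open>mult_matrix\<close> lie in the image of the
  injection \<^const>\<open>of_poly\<close> (lemma \<open>mult_matrix_complex\<close> below), so they can be read as
  polynomials in \<open>\<complex>[x\<^sub>1, \<dots>, x\<^sub>n]\<close>.
\<close>

definition mult_matrix_poly ::
  "('n::{finite,linorder}, complex) laurent \<Rightarrow> ('n, complex) mpoly^('n set)^('n set)" where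
  "mult_matrix_poly g = map_matrix (inv_into UNIV of_poly) (mult_matrix (extend_scalars g))"

definition concat_matrices :: "('r::finite \<Rightarrow> 'a^'c^'m) \<Rightarrow> 'a^('r \<times> 'c::finite)^'m::finite" where
  "concat_matrices M = (\<chi> i rc. M (fst rc) $ i $ snd rc)"

definition eval_matrix :: "('n::finite, 'k::field) mpoly^'c^'m \<Rightarrow> 'k^'n \<Rightarrow> 'k^'c::finite^'m::finite" where
  "eval_matrix M x = map_matrix (\<lambda>p. poly_eval p x) M"

subsection \<open>The multiplication matrices are well defined\<close>

interpretation ring_module: Modules.module "(*) :: 'a::comm_ring_1 \<Rightarrow> 'a \<Rightarrow> 'a"
  by standard (simp_all add: algebra_simps)

lemma sum_monomials: "p = (\<Sum>m\<in>Poly_Mapping.keys p. Poly_Mapping.single m (Poly_Mapping.lookup p m))"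
proof (rule poly_mapping_eqI)
  fix k
  have "Poly_Mapping.lookup (\<Sum>m\<in>Poly_Mapping.keys p. Poly_Mapping.single m (Poly_Mapping.lookup p m)) k
      = (\<Sum>m\<in>Poly_Mapping.keys p. if m = k then Poly_Mapping.lookup p k else 0)"
    by (simp add: Poly_Mapping.lookup_sum lookup_single when_def)
  also have "\<dots> = Poly_Mapping.lookup p k"
    by (simp add: in_keys_iff)
  finally show "Poly_Mapping.lookup p k =
    Poly_Mapping.lookup (\<Sum>m\<in>Poly_Mapping.keys p. Poly_Mapping.single m (Poly_Mapping.lookup p m)) k" ..
qed

lemma laurent_eval_superset:
  assumes "finite F" "Poly_Mapping.keys g \<subseteq> F"
  shows "laurent_eval g y =
    (\<Sum>m\<in>F. Poly_Mapping.lookup g m * (\<Prod>j\<in>UNIV. (y $ j) powi Poly_Mapping.lookup m j))"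
  unfolding laurent_eval_def
  by (rule sum.mono_neutral_left) (use assms in \<open>auto simp: in_keys_iff\<close>)

lemma laurent_eval_single:
  "laurent_eval (Poly_Mapping.single m c) y = c * (\<Prod>j\<in>UNIV. (y $ j) powi Poly_Mapping.lookup m j)"
  by (subst laurent_eval_superset[of "{m}"]) auto

lemma laurent_eval_0 [simp]: "laurent_eval 0 y = 0"
  by (simp add: laurent_eval_def)

lemma laurent_eval_add: "laurent_eval (f + g) y = laurent_eval f y + laurent_eval g y"
proof -
  let ?F = "Poly_Mapping.keys f \<union> Poly_Mapping.keys g"
  have "Poly_Mapping.keys (f + g) \<subseteq> ?F" by (rule keys_add)
  then show ?thesis
    by (simp add: laurent_eval_superset[of ?F] lookup_add distrib_right sum.distrib)
qed

lemma laurent_eval_minus: "laurent_eval (- f) y = - laurent_eval f y"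
  using laurent_eval_add[of "- f" f y] by (simp add: add_eq_0_iff)

lemma laurent_eval_diff: "laurent_eval (f - g) y = laurent_eval f y - laurent_eval g y"
  using laurent_eval_add[of f "- g" y] by (simp add: laurent_eval_minus)

lemma laurent_eval_sum: "laurent_eval (sum f I) y = (\<Sum>i\<in>I. laurent_eval (f i) y)"
  by (induction I rule: infinite_finite_induct) (simp_all add: laurent_eval_add)

lemma laurent_eval_mult:
  assumes "y \<in> torus"
  shows "laurent_eval (f * g) y = laurent_eval f y * laurent_eval g y"
proof -
  have single: "laurent_eval (Poly_Mapping.single m a * Poly_Mapping.single k c) y
      = laurent_eval (Poly_Mapping.single m a) y * laurent_eval (Poly_Mapping.single k c) y"
    for m k a c
    using assms
    by (simp add: mult_single laurent_eval_single lookup_add power_int_add torus_def prod.distrib)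
  have "laurent_eval (f * g) y = laurent_eval
      ((\<Sum>m\<in>Poly_Mapping.keys f. Poly_Mapping.single m (Poly_Mapping.lookup f m)) *
       (\<Sum>m\<in>Poly_Mapping.keys g. Poly_Mapping.single m (Poly_Mapping.lookup g m))) y"
    by (simp flip: sum_monomials)
  also have "\<dots> = laurent_eval
      (\<Sum>m\<in>Poly_Mapping.keys f. Poly_Mapping.single m (Poly_Mapping.lookup f m)) y * laurent_eval
      (\<Sum>m\<in>Poly_Mapping.keys g. Poly_Mapping.single m (Poly_Mapping.lookup g m)) y"
    unfolding sum_product laurent_eval_sum single ..
  finally show ?thesis by (simp flip: sum_monomials)
qed

lemma laurent_eval_scalar [simp]: "laurent_eval (scalar c) y = c"
  by (simp add: scalar_def laurent_eval_single)

lemma laurent_eval_yvar_power [simp]: "laurent_eval (yvar_power j k) y = (y $ j) powi k"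
proof -
  have "(\<Prod>i\<in>UNIV. (y $ i) powi Poly_Mapping.lookup (Poly_Mapping.single j k) i)
      = (\<Prod>i\<in>UNIV. if i = j then (y $ j) powi k else 1)"
    by (rule prod.cong) (auto simp: lookup_single when_def)
  then show ?thesis by (simp add: yvar_power_def laurent_eval_single)
qed

lemma laurent_eval_basis_mon:
  assumes "y \<in> torus"
  shows "laurent_eval (basis_mon S) y = (\<Prod>j\<in>S. y $ j)"
proof -
  have one: "laurent_eval 1 y = 1"
    using laurent_eval_single[of 0 1 y] by simp
  have "finite S \<Longrightarrow> laurent_eval (\<Prod>j\<in>S. yvar_power j 1) y = (\<Prod>j\<in>S. y $ j)" for S
    by (induction S rule: finite_induct) (simp_all add: laurent_eval_mult one assms)
  then show ?thesis unfolding basis_mon_def by simp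
qed

lemma of_poly_add: "of_poly (p + q) = of_poly p + of_poly q"
  by (simp add: of_poly_def flip: to_ac_add)

lemma of_poly_diff: "of_poly (p - q) = of_poly p - of_poly q"
  by (simp add: of_poly_def flip: to_ac_diff)

lemma of_poly_mult: "of_poly (p * q) = of_poly p * of_poly q"
  by (simp add: of_poly_def flip: to_ac_mult)

lemma of_poly_0 [simp]: "of_poly 0 = 0" and of_poly_1 [simp]: "of_poly 1 = 1"
  by (simp_all add: of_poly_def flip: Zero_fract_def One_fract_def)

lemma of_poly_sum: "of_poly (sum f I) = (\<Sum>i\<in>I. of_poly (f i))"
  by (induction I rule: infinite_finite_induct) (simp_all add: of_poly_add)

lemma inj_of_poly: "inj of_poly"
  by (auto simp: inj_on_def of_poly_def eq_fract)

lemma multilinear_grid: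
  fixes c :: "'n set \<Rightarrow> 'k::field" and t t' :: "'n \<Rightarrow> 'k"
  assumes "finite F" and "\<And>j. t j \<noteq> t' j"
    and "\<And>y. (\<And>j. y j = t j \<or> y j = t' j) \<Longrightarrow> (\<Sum>T\<in>Pow F. c T * (\<Prod>j\<in>T. y j)) = 0"
  shows "\<forall>T\<in>Pow F. c T = 0"
  using assms(1,3)
proof (induction F arbitrary: c rule: finite_induct)
  case empty
  from empty.prems[of t] show ?case by simp
next
  case (insert i F)
  have split: "(\<Sum>T\<in>Pow (insert i F). c T * (\<Prod>j\<in>T. y j))
      = (\<Sum>T\<in>Pow F. (c T + c (insert i T) * y i) * (\<Prod>j\<in>T. y j))" for y
  proof -
    have inj: "inj_on (insert i) (Pow F)"
      using insert.hyps by (auto simp: inj_on_def)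
    have "(\<Sum>T\<in>Pow (insert i F). c T * (\<Prod>j\<in>T. y j))
        = (\<Sum>T\<in>Pow F. c T * (\<Prod>j\<in>T. y j)) + (\<Sum>T\<in>insert i ` Pow F. c T * (\<Prod>j\<in>T. y j))"
      unfolding Pow_insert
      by (rule sum.union_disjoint) (use insert.hyps in auto)
    also have "(\<Sum>T\<in>insert i ` Pow F. c T * (\<Prod>j\<in>T. y j))
        = (\<Sum>T\<in>Pow F. c (insert i T) * (y i * (\<Prod>j\<in>T. y j)))"
      unfolding sum.reindex[OF inj] o_def
    proof (rule sum.cong)
      fix T assume "T \<in> Pow F"
      then have "finite T" "i \<notin> T" using insert.hyps by (auto intro: finite_subset)
      then show "c (insert i T) * (\<Prod>j\<in>insert i T. y j) = c (insert i T) * (y i * (\<Prod>j\<in>T. y j))"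
        by simp
    qed simp
    finally show ?thesis by (simp only: distrib_right sum.distrib mult.assoc)
  qed
  have zero: "\<forall>T\<in>Pow F. c T + c (insert i T) * s = 0" if "s = t i \<or> s = t' i" for s
  proof (rule insert.IH)
    fix y :: "'n \<Rightarrow> 'k" assume y: "\<And>j. y j = t j \<or> y j = t' j"
    have "(\<Sum>T\<in>Pow F. (c T + c (insert i T) * s) * (\<Prod>j\<in>T. (y(i := s)) j)) = 0"
    proof -
      have "(\<Sum>T\<in>Pow (insert i F). c T * (\<Prod>j\<in>T. (y(i := s)) j)) = 0"
        by (rule insert.prems) (use y that in auto)
      then show ?thesis unfolding split by simp
    qed
    moreover have "(\<Prod>j\<in>T. (y(i := s)) j) = (\<Prod>j\<in>T. y j)" if "T \<in> Pow F" for T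
      by (rule prod.cong) (use that insert.hyps in auto)
    ultimately show "(\<Sum>T\<in>Pow F. (c T + c (insert i T) * s) * (\<Prod>j\<in>T. y j)) = 0"
      by simp
  qed
  have both: "c T = 0 \<and> c (insert i T) = 0" if "T \<in> Pow F" for T
  proof -
    have "c T + c (insert i T) * t i = 0" "c T + c (insert i T) * t' i = 0"
      using zero that by blast+
    moreover have "c (insert i T) * (t i - t' i)
        = (c T + c (insert i T) * t i) - (c T + c (insert i T) * t' i)"
      by (simp add: algebra_simps)
    ultimately have "c (insert i T) * (t i - t' i) = 0" by simp
    with assms(2)[of i] have "c (insert i T) = 0" by simp
    with \<open>c T + c (insert i T) * t i = 0\<close> show ?thesis by simp
  qed
  then show ?case by (auto simp: Pow_insert)
qed

lemma of_poly_xvar_square: "(of_poly (xvar j))\<^sup>2 \<noteq> 1"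
proof
  assume "(of_poly (xvar j))\<^sup>2 = (1 :: 'a ratfun_closure)"
  then have "of_poly (xvar j * xvar j) = (of_poly 1 :: 'a ratfun_closure)"
    by (simp add: power2_eq_square of_poly_mult)
  then have "xvar j * xvar j = (1 :: ('a, complex) mpoly)"
    by (rule injD[OF inj_of_poly])
  moreover define m :: "'a \<Rightarrow>\<^sub>0 nat" where "m = Poly_Mapping.single j 1 + Poly_Mapping.single j 1"
  ultimately have "Poly_Mapping.single m (1::complex) = Poly_Mapping.single 0 1"
    by (simp add: xvar_def mult_single)
  then have "Poly_Mapping.lookup (Poly_Mapping.single 0 (1::complex)) m = 1"
    by (metis lookup_single_eq)
  then have "m = 0" by (metis lookup_single_not_eq zero_neq_one)
  then have "Poly_Mapping.lookup m j = 0" by simp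
  then show False by (simp add: m_def lookup_add)
qed

lemma of_poly_two: "of_poly 2 = (2 :: 'n::{finite,linorder} ratfun_closure)"
proof -
  have "of_poly (1 + 1) = (1 + 1 :: 'n ratfun_closure)" unfolding of_poly_add by simp
  then show ?thesis by simp
qed

lemma two_roots:
  fixes j :: "'n::{finite,linorder}"
  shows "\<exists>t t' :: 'n ratfun_closure. t \<noteq> t' \<and> t \<noteq> 0 \<and> t' \<noteq> 0 \<and>
    (\<forall>s\<in>{t, t'}. of_poly (2 * xvar j) - s - inverse s = 0)"
proof -
  define \<xi> :: "'n ratfun_closure" where "\<xi> = of_poly (xvar j)"
  have "\<exists>r. (\<Sum>k\<le>2. (if k = 0 then 1 - \<xi>\<^sup>2 else if k = 2 then 1 else 0) * r ^ k) = 0"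
    by (rule alg_closed) auto
  then obtain r where "r\<^sup>2 + 1 - \<xi>\<^sup>2 = 0"
    by (auto simp: numeral_2_eq_2 algebra_simps)
  then have r: "r * r = \<xi> * \<xi> - 1" by (simp add: power2_eq_square algebra_simps)
  have r0: "r \<noteq> 0"
  proof
    assume "r = 0"
    with r have "\<xi>\<^sup>2 = 1" by (simp add: power2_eq_square)
    then show False using of_poly_xvar_square[of j] by (simp add: \<xi>_def)
  qed
  have prod1: "(\<xi> + r) * (\<xi> - r) = 1" using r by (simp add: algebra_simps)
  then have recip: "inverse (\<xi> + r) = \<xi> - r" "inverse (\<xi> - r) = \<xi> + r"
    by (simp_all add: inverse_unique mult.commute)
  have char: "(2 :: ('n, complex) mpoly) \<noteq> 0"
    by simp
  have "of_poly (2 :: ('n, complex) mpoly) \<noteq> (of_poly 0 :: 'n ratfun_closure)"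
    using char injD[OF inj_of_poly] by metis
  then have "(2 :: 'n ratfun_closure) \<noteq> 0"
    by (simp add: of_poly_two)
  then have ne: "\<xi> + r \<noteq> \<xi> - r"
    using r0 by (simp add: eq_diff_eq flip: mult_2)
  have two: "of_poly (2 * xvar j) = 2 * \<xi>"
    by (simp add: of_poly_mult of_poly_two \<xi>_def)
  have "\<forall>s\<in>{\<xi> + r, \<xi> - r}. of_poly (2 * xvar j) - s - inverse s = 0"
    by (simp add: recip two)
  moreover have "\<xi> + r \<noteq> 0" "\<xi> - r \<noteq> 0" using prod1 by auto
  ultimately show ?thesis using ne by blast
qed

lemma basis_independent:
  fixes c :: "'n::{finite,linorder} set \<Rightarrow> 'n ratfun_closure"
  assumes "(\<Sum>T\<in>UNIV. scalar (c T) * basis_mon T) \<in> rel_ideal"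
  shows "c T = 0"
proof -
  obtain t t' :: "'n \<Rightarrow> 'n ratfun_closure"
    where t: "\<And>j. t j \<noteq> t' j" "\<And>j. t j \<noteq> 0" "\<And>j. t' j \<noteq> 0"
      "\<And>j s. s = t j \<or> s = t' j \<Longrightarrow> of_poly (2 * xvar j) - s - inverse s = 0"
  proof -
    have "\<forall>j :: 'n. \<exists>p :: 'n ratfun_closure \<times> 'n ratfun_closure. fst p \<noteq> snd p \<and> fst p \<noteq> 0 \<and> snd p \<noteq> 0 \<and>
      (\<forall>s\<in>{fst p, snd p}. of_poly (2 * xvar j) - s - inverse s = 0)"
      using two_roots by (simp only: split_paired_Ex fst_conv snd_conv) blast
    then obtain p where p: "\<forall>j :: 'n. fst (p j :: 'n ratfun_closure \<times> 'n ratfun_closure) \<noteq> snd (p j) \<and>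
      fst (p j) \<noteq> 0 \<and> snd (p j) \<noteq> 0 \<and>
      (\<forall>s\<in>{fst (p j), snd (p j)}. of_poly (2 * xvar j) - s - inverse s = 0)"
      by (rule choice[THEN exE])
    show ?thesis
      by (rule that[of "\<lambda>j. fst (p j)" "\<lambda>j. snd (p j)"]) (use p in blast)+
  qed
  have "\<forall>T\<in>Pow UNIV. c T = 0"
  proof (rule multilinear_grid[where t = t and t' = t'])
    fix y :: "'n \<Rightarrow> 'n ratfun_closure" assume y: "\<And>j. y j = t j \<or> y j = t' j"
    define v where "v = (\<chi> j. y j)"
    have v: "v \<in> torus" unfolding torus_def v_def by (auto, metis y t(2,3))
    have "ring_module.subspace {h. laurent_eval h v = 0}"
      by (auto simp: ring_module.subspace_def laurent_eval_add laurent_eval_mult v)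
    moreover have "Set.range f_rel \<subseteq> {h. laurent_eval h v = 0}"
      using t(4)[OF y] by (auto simp: f_rel_def laurent_eval_diff v_def power_int_minus)
    ultimately have "rel_ideal \<subseteq> {h. laurent_eval h v = 0}"
      unfolding rel_ideal_def by (intro ring_module.span_minimal)
    with assms have "laurent_eval (\<Sum>T\<in>UNIV. scalar (c T) * basis_mon T) v = 0" by auto
    then show "(\<Sum>T\<in>Pow UNIV. c T * (\<Prod>j\<in>T. y j)) = 0"
      by (simp add: laurent_eval_sum laurent_eval_mult laurent_eval_basis_mon v)
         (simp add: v_def)
  qed (use t in auto)
  then show ?thesis by simp
qed

lemma scalar_hom:
  "scalar 0 = 0" "scalar 1 = 1" "scalar (a + c) = scalar a + scalar c"
  "scalar (a - c) = scalar a - scalar c" "scalar (a * c) = scalar a * scalar c"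
  by (simp_all add: scalar_def single_add single_diff mult_single)

lemma is_mult_matrix_unique:
  assumes "is_mult_matrix g M" "is_mult_matrix g N"
  shows "M = N"
proof -
  have "M $ T $ S - N $ T $ S = 0" for T S
  proof (rule basis_independent[of "\<lambda>T. M $ T $ S - N $ T $ S"])
    have "(g * basis_mon S - (\<Sum>T\<in>UNIV. scalar (N $ T $ S) * basis_mon T))
        - (g * basis_mon S - (\<Sum>T\<in>UNIV. scalar (M $ T $ S) * basis_mon T)) \<in> rel_ideal"
      using assms unfolding is_mult_matrix_def rel_ideal_def
      by - (rule ring_module.span_diff, auto)
    then show "(\<Sum>T\<in>UNIV. scalar (M $ T $ S - N $ T $ S) * basis_mon T) \<in> rel_ideal"
      by (simp add: scalar_hom left_diff_distrib sum_subtractf)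
  qed
  then show ?thesis by (simp add: vec_eq_iff)
qed

lemma mult_matrix_eqI: "is_mult_matrix g M \<Longrightarrow> mult_matrix g = M"
  unfolding mult_matrix_def by (rule the_equality, assumption, rule is_mult_matrix_unique)

text \<open>Elements of \<open>K[y\<^sup>\<plusminus>\<^sup>1]\<close> congruent to a combination of basis monomials over \<open>\<complex>[x\<^sub>1, \<dots>, x\<^sub>n]\<close>.\<close>

definition poly_reducible :: "('n::{finite,linorder}, 'n ratfun_closure) laurent set" where
  "poly_reducible =
     {h. \<exists>c. h - (\<Sum>T\<in>UNIV. scalar (of_poly (c T)) * basis_mon T) \<in> rel_ideal}"

lemma poly_reducible_add:
  assumes "h \<in> poly_reducible" "k \<in> poly_reducible"
  shows "h + k \<in> poly_reducible"
proof -
  obtain c d where "h - (\<Sum>T\<in>UNIV. scalar (of_poly (c T)) * basis_mon T) \<in> rel_ideal"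
    "k - (\<Sum>T\<in>UNIV. scalar (of_poly (d T)) * basis_mon T) \<in> rel_ideal"
    using assms unfolding poly_reducible_def by blast
  then have "(h - (\<Sum>T\<in>UNIV. scalar (of_poly (c T)) * basis_mon T)) +
     (k - (\<Sum>T\<in>UNIV. scalar (of_poly (d T)) * basis_mon T)) \<in> rel_ideal"
    unfolding rel_ideal_def by (rule ring_module.span_add)
  then have "h + k - (\<Sum>T\<in>UNIV. scalar (of_poly (c T + d T)) * basis_mon T) \<in> rel_ideal"
    by (simp add: of_poly_add scalar_hom distrib_right sum.distrib algebra_simps)
  then show ?thesis unfolding poly_reducible_def
    by (intro CollectI exI[of _ "\<lambda>T. c T + d T"])
qed

lemma poly_reducible_scale:
  assumes "h \<in> poly_reducible"
  shows "scalar (of_poly p) * h \<in> poly_reducible"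
proof -
  obtain c where "h - (\<Sum>T\<in>UNIV. scalar (of_poly (c T)) * basis_mon T) \<in> rel_ideal"
    using assms unfolding poly_reducible_def by blast
  then have "scalar (of_poly p) * (h - (\<Sum>T\<in>UNIV. scalar (of_poly (c T)) * basis_mon T)) \<in> rel_ideal"
    unfolding rel_ideal_def by (rule ring_module.span_scale)
  then have "scalar (of_poly p) * h - (\<Sum>T\<in>UNIV. scalar (of_poly (p * c T)) * basis_mon T) \<in> rel_ideal"
    by (simp only: of_poly_mult scalar_hom(5) right_diff_distrib sum_distrib_left mult.assoc)
  then show ?thesis unfolding poly_reducible_def
    by (intro CollectI exI[of _ "\<lambda>T. p * c T"])
qed

lemma poly_reducible_cong:
  assumes "h - k \<in> rel_ideal" "k \<in> poly_reducible"
  shows "h \<in> poly_reducible"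
proof -
  obtain c where "k - (\<Sum>T\<in>UNIV. scalar (of_poly (c T)) * basis_mon T) \<in> rel_ideal"
    using assms unfolding poly_reducible_def by blast
  then have "(h - k) + (k - (\<Sum>T\<in>UNIV. scalar (of_poly (c T)) * basis_mon T)) \<in> rel_ideal"
    using assms(1) unfolding rel_ideal_def by - (rule ring_module.span_add)
  then have "h - (\<Sum>T\<in>UNIV. scalar (of_poly (c T)) * basis_mon T) \<in> rel_ideal" by simp
  then show ?thesis unfolding poly_reducible_def by blast
qed

lemma poly_reducible_basis:
  fixes S :: "'n::{finite,linorder} set"
  shows "basis_mon S \<in> poly_reducible"
proof -
  have "(\<Sum>T\<in>UNIV. scalar (of_poly (if T = S then 1 else (0 :: ('n, complex) mpoly))) * basis_mon T)
      = (\<Sum>T\<in>UNIV. if T = S then basis_mon T else 0)"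
    by (rule sum.cong) (auto simp: scalar_hom)
  also have "\<dots> = basis_mon S" by simp
  finally have "basis_mon S - (\<Sum>T\<in>UNIV. scalar (of_poly (if T = S then 1 else (0 :: ('n, complex) mpoly))) * basis_mon T) = 0"
    by (simp only: diff_self)
  then have "basis_mon S - (\<Sum>T\<in>UNIV. scalar (of_poly (if T = S then 1 else (0 :: ('n, complex) mpoly))) * basis_mon T) \<in> rel_ideal"
    unfolding rel_ideal_def by (simp only: ring_module.span_zero)
  then show ?thesis unfolding poly_reducible_def
    by (intro CollectI exI[of _ "\<lambda>T. if T = S then 1 else 0"])
qed

lemma poly_reducible_0: "0 \<in> poly_reducible"
  using poly_reducible_scale[OF poly_reducible_basis, of 0] by (simp add: scalar_hom)

lemma poly_reducible_sum:
  "(\<And>i. i \<in> I \<Longrightarrow> h i \<in> poly_reducible) \<Longrightarrow> sum h I \<in> poly_reducible"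
  by (induction I rule: infinite_finite_induct) (auto intro: poly_reducible_add poly_reducible_0)

lemma yvar_power_add: "yvar_power j (k + l) = yvar_power j k * yvar_power j l"
  by (simp add: yvar_power_def mult_single single_add)

lemma yvar_power_0: "yvar_power j 0 = 1"
  by (simp add: yvar_power_def)

lemma yvar_inverse: "yvar_power j 1 * yvar_power j (-1) = 1"
  using yvar_power_add[of j 1 "-1"] by (simp add: yvar_power_0)

lemma yvar_basis_notin: "j \<notin> S \<Longrightarrow> yvar_power j 1 * basis_mon S = basis_mon (insert j S)"
  for S :: "'n::finite set"
  by (simp add: basis_mon_def)

lemma yvar_basis_in: "j \<in> S \<Longrightarrow> basis_mon S = yvar_power j 1 * basis_mon (S - {j})"
  for S :: "'n::finite set"
  by (metis finite insert_Diff_single insert_absorb yvar_basis_notin DiffD2 singletonI)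

lemma rel_identity_inverse: "(- h) * (s - y - z) = z * h - (s * h - y * h)"
  for h s y z :: "'a::comm_ring_1"
  by (simp add: algebra_simps)

lemma rel_identity_square: "(- (y * h)) * (s - y - z) = y * (y * h) - (s * (y * h) - (y * z) * h)"
  for h s y z :: "'a::comm_ring_1"
  by (simp only: rel_identity_inverse mult.left_commute[of z y] mult.assoc diff_diff_eq2 add.commute)

lemma yvar_inverse_cong:
  "yvar_power j (-1) * h - (scalar (of_poly (2 * xvar j)) * h - yvar_power j 1 * h) \<in> rel_ideal"
proof -
  have "(- h) * f_rel j \<in> rel_ideal"
    unfolding rel_ideal_def by (intro ring_module.span_scale ring_module.span_base) auto
  then show ?thesis unfolding f_rel_def rel_identity_inverse .
qed

lemma yvar_square_cong:
  "yvar_power j 1 * (yvar_power j 1 * h) - (scalar (of_poly (2 * xvar j)) * (yvar_power j 1 * h) - h)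
    \<in> rel_ideal"
proof -
  have "(- (yvar_power j 1 * h)) * f_rel j \<in> rel_ideal"
    unfolding rel_ideal_def by (intro ring_module.span_scale ring_module.span_base) auto
  then show ?thesis unfolding f_rel_def rel_identity_square yvar_inverse mult_1_left .
qed

lemma of_poly_uminus: "of_poly (- p) = - of_poly p"
  using of_poly_diff[of 0 p] by simp

lemma scalar_minus_one: "scalar (- 1) = - 1"
  using scalar_hom(4)[of 0 1] by (simp add: scalar_hom(1,2))

lemma poly_reducible_diff:
  fixes h k :: "('n::{finite,linorder}, 'n ratfun_closure) laurent"
  assumes "h \<in> poly_reducible" "k \<in> poly_reducible"
  shows "h - k \<in> poly_reducible"
proof -
  have "scalar (of_poly (- 1) :: 'n ratfun_closure) * k = - k"
    by (simp only: of_poly_uminus of_poly_1 scalar_minus_one mult_minus_left mult_1_left)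
  with poly_reducible_add[OF assms(1) poly_reducible_scale[OF assms(2), of "- 1"]]
  show ?thesis by (simp only: diff_conv_add_uminus)
qed

lemma poly_reducible_yvar_basis: "yvar_power j 1 * basis_mon S \<in> poly_reducible"
proof (cases "j \<in> S")
  case False
  then show ?thesis by (simp add: yvar_basis_notin poly_reducible_basis)
next
  case True
  have "scalar (of_poly (2 * xvar j)) * basis_mon S - basis_mon (S - {j}) \<in> poly_reducible"
    by (intro poly_reducible_diff poly_reducible_scale poly_reducible_basis)
  moreover have "yvar_power j 1 * basis_mon S
      - (scalar (of_poly (2 * xvar j)) * basis_mon S - basis_mon (S - {j})) \<in> rel_ideal"
    using yvar_square_cong[of j "basis_mon (S - {j})"] by (simp only: yvar_basis_in[OF True, symmetric])
  ultimately show ?thesis by (rule poly_reducible_cong[rotated])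
qed

lemma poly_reducible_yvar:
  assumes "h \<in> poly_reducible"
  shows "yvar_power j 1 * h \<in> poly_reducible"
proof -
  obtain c where "h - (\<Sum>T\<in>UNIV. scalar (of_poly (c T)) * basis_mon T) \<in> rel_ideal"
    using assms unfolding poly_reducible_def by blast
  then have "yvar_power j 1 * (h - (\<Sum>T\<in>UNIV. scalar (of_poly (c T)) * basis_mon T)) \<in> rel_ideal"
    unfolding rel_ideal_def by (rule ring_module.span_scale)
  then have "yvar_power j 1 * h
      - (\<Sum>T\<in>UNIV. scalar (of_poly (c T)) * (yvar_power j 1 * basis_mon T)) \<in> rel_ideal"
    by (simp only: right_diff_distrib sum_distrib_left mult.left_commute)
  then show ?thesis
    by (rule poly_reducible_cong)
       (intro poly_reducible_sum poly_reducible_scale poly_reducible_yvar_basis)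
qed

lemma poly_reducible_yvar_inverse:
  assumes "h \<in> poly_reducible"
  shows "yvar_power j (-1) * h \<in> poly_reducible"
  by (rule poly_reducible_cong[OF yvar_inverse_cong])
     (intro poly_reducible_diff poly_reducible_scale poly_reducible_yvar assms)

lemma poly_reducible_yvar_power:
  assumes "h \<in> poly_reducible"
  shows "yvar_power j k * h \<in> poly_reducible"
proof (induction k rule: int_induct[where k = 0])
  case base
  then show ?case by (simp add: yvar_power_0 assms)
next
  case (step1 i)
  from poly_reducible_yvar[OF step1.IH, of j] show ?case
    by (simp only: add.commute[of i 1] yvar_power_add mult.assoc)
next
  case (step2 i)
  have "i - 1 = - 1 + i" by simp
  with poly_reducible_yvar_inverse[OF step2.IH, of j] show ?case
    by (simp only: yvar_power_add mult.assoc)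
qed

lemma monomial_eq_prod:
  fixes m :: "'n::finite \<Rightarrow>\<^sub>0 int"
  shows "Poly_Mapping.single m (1::'k::field) =
    (\<Prod>j\<in>Poly_Mapping.keys m. yvar_power j (Poly_Mapping.lookup m j))"
proof -
  have "(\<Prod>j\<in>F. yvar_power j (Poly_Mapping.lookup m j) :: ('n, 'k) laurent)
      = Poly_Mapping.single (\<Sum>j\<in>F. Poly_Mapping.single j (Poly_Mapping.lookup m j)) 1"
    if "finite F" for F
    using that by (induction F rule: finite_induct) (simp_all add: yvar_power_def mult_single)
  from this[OF finite_keys[of m]] show ?thesis by (simp only: sum_monomials[symmetric])
qed

lemma poly_reducible_monomial:
  fixes m :: "'n::{finite,linorder} \<Rightarrow>\<^sub>0 int"
  assumes "h \<in> poly_reducible"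
  shows "Poly_Mapping.single m 1 * h \<in> poly_reducible"
proof -
  have "(\<Prod>j\<in>F. yvar_power j (Poly_Mapping.lookup m j)) * h \<in> poly_reducible" if "finite F" for F
    using that
  proof (induction F rule: finite_induct)
    case empty
    from assms show ?case by (simp only: prod.empty mult_1_left)
  next
    case (insert i F)
    from poly_reducible_yvar_power[OF insert.IH] show ?case
      by (simp only: prod.insert[OF insert.hyps] mult.assoc)
  qed
  then show ?thesis by (simp only: monomial_eq_prod finite_keys)
qed

lemma poly_reducible_extend:
  assumes "h \<in> poly_reducible"
  shows "extend_scalars g * h \<in> poly_reducible"
proof -
  have "extend_scalars g = (\<Sum>m\<in>Poly_Mapping.keys g.
      scalar (of_poly (Poly_Mapping.single 0 (Poly_Mapping.lookup g m))) * Poly_Mapping.single m 1)"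
    unfolding extend_scalars_def
    by (rule poly_mapping_eqI)
       (simp add: map.rep_eq when_def in_keys_iff Poly_Mapping.lookup_sum scalar_def mult_single
        lookup_single)
  then show ?thesis
    by (simp only: sum_distrib_right mult.assoc)
       (intro poly_reducible_sum poly_reducible_scale poly_reducible_monomial assms)
qed

lemma mult_matrix_complex:
  fixes g :: "('n::{finite,linorder}, complex) laurent"
  shows "is_mult_matrix (extend_scalars g) (mult_matrix (extend_scalars g))"
    and "map_matrix of_poly (mult_matrix_poly g) = mult_matrix (extend_scalars g)"
proof -
  have "\<forall>S. \<exists>c. extend_scalars g * basis_mon S
     - (\<Sum>T\<in>UNIV. scalar (of_poly (c T)) * basis_mon T) \<in> rel_ideal"
    using poly_reducible_extend[OF poly_reducible_basis, of g] unfolding poly_reducible_def by blast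
  then obtain c where "\<forall>S. extend_scalars g * basis_mon S
     - (\<Sum>T\<in>UNIV. scalar (of_poly (c S T)) * basis_mon T) \<in> rel_ideal"
    by (rule choice[THEN exE])
  then have M: "is_mult_matrix (extend_scalars g) (map_matrix of_poly (\<chi> T S. c S T))"
    by (simp add: is_mult_matrix_def)
  then have eq: "mult_matrix (extend_scalars g) = map_matrix of_poly (\<chi> T S. c S T)"
    by (rule mult_matrix_eqI)
  with M show "is_mult_matrix (extend_scalars g) (mult_matrix (extend_scalars g))" by simp
  show "map_matrix of_poly (mult_matrix_poly g) = mult_matrix (extend_scalars g)"
    by (simp add: mult_matrix_poly_def eq vec_eq_iff inj_of_poly)
qed

text \<open>\<open>M\<close> of \<open>y\<^sub>j\<close> is the Kronecker product with \<open>((0, -1), (1, 2 x\<^sub>j))\<close> in position \<open>j\<close>.\<close>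

lemma mult_matrix_yvar:
  fixes j :: "'n::{finite,linorder}"
  shows "mult_matrix (yvar_power j 1) $ T $ S =
    (if T - {j} \<noteq> S - {j} then 0
     else if j \<in> S then (if j \<in> T then of_poly (2 * xvar j) else - 1)
     else (if j \<in> T then 1 else 0))"
proof -
  define M :: "'n ratfun_closure^('n set)^('n set)" where "M = (\<chi> T S. if T - {j} \<noteq> S - {j} then 0
     else if j \<in> S then (if j \<in> T then of_poly (2 * xvar j) else - 1)
     else (if j \<in> T then 1 else 0))"
  have "yvar_power j 1 * basis_mon S - (\<Sum>T\<in>UNIV. scalar (M $ T $ S) * basis_mon T) \<in> rel_ideal" for S
  proof -
    have *: "T - {j} = S - {j} \<longleftrightarrow> T = insert j S \<or> T = S - {j}" for T by auto
    have "(\<Sum>T\<in>UNIV. scalar (M $ T $ S) * basis_mon T)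
       = (\<Sum>T\<in>{insert j S, S - {j}}. scalar (M $ T $ S) * basis_mon T)"
      by (rule sum.mono_neutral_right) (auto simp: M_def * scalar_hom)
    also have "\<dots> = scalar (M $ insert j S $ S) * basis_mon (insert j S)
       + scalar (M $ (S - {j}) $ S) * basis_mon (S - {j})"
      by (subst sum.insert) auto
    finally have sum: "(\<Sum>T\<in>UNIV. scalar (M $ T $ S) * basis_mon T) = \<dots>" .
    show ?thesis
    proof (cases "j \<in> S")
      case False
      then show ?thesis
        unfolding sum
        by (simp add: M_def scalar_hom yvar_basis_notin rel_ideal_def ring_module.span_zero)
    next
      case True
      have "yvar_power j 1 * basis_mon S
          - (scalar (of_poly (2 * xvar j)) * basis_mon S - basis_mon (S - {j})) \<in> rel_ideal"
        using yvar_square_cong[of j "basis_mon (S - {j})"] by (simp only: yvar_basis_in[OF True, symmetric])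
      moreover have "scalar (M $ insert j S $ S) * basis_mon (insert j S)
          + scalar (M $ (S - {j}) $ S) * basis_mon (S - {j})
          = scalar (of_poly (2 * xvar j)) * basis_mon S - basis_mon (S - {j})"
        using True by (simp add: M_def insert_absorb scalar_minus_one)
      ultimately show ?thesis unfolding sum by simp
    qed
  qed
  then have M: "is_mult_matrix (yvar_power j 1) M" by (simp add: is_mult_matrix_def)
  have "mult_matrix (yvar_power j 1) = M"
    by (rule mult_matrix_eqI[OF M])
  then show ?thesis by (simp add: M_def)
qed

end

(*
  The matrices M_g(x) form a representation of the Laurent polynomial ring in which M_{y_j}(x)
  satisfies t^2 - 2 x_j t + 1 = 0.  The concatenated matrix is rank deficient iff it has a nonzero
  left kernel.  That kernel is invariant under the commuting matrices M_{y_j}(x), so it contains a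
  common eigenvector; its eigenvalues form a point y of the torus with 2 x_j = y_j + 1 / y_j at
  which every g_k vanishes.  Conversely such a y gives the kernel vector with entries
  prod_{j in S} y_j.  Finally y_j = exp (i u_j) turns these points into the points of L_{A,b},
  because a toric variety meets the torus exactly in the image of its monomial map.
*)

theory Submission
  imports Defs
begin

no_notation fps_nth (infixl "$" 75)

text \<open>
  The interpretation \<open>ring_module\<close> makes \<open>a * (b * x) = a * b * x\<close> a simplification rule, which
  loops with \<open>ac_simps\<close> and \<open>algebra_simps\<close>.
\<close>

declare ring_module.scale_scale [simp del]

section \<open>Evaluation of polynomials is a ring homomorphism\<close>

lemma poly_eval_superset:
  assumes "finite F" "Poly_Mapping.keys p \<subseteq> F"
  shows "poly_eval p y =
    (\<Sum>m\<in>F. Poly_Mapping.lookup p m * (\<Prod>j\<in>UNIV. (y $ j) ^ Poly_Mapping.lookup m j))"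
  unfolding poly_eval_def
  by (rule sum.mono_neutral_left) (use assms in \<open>auto simp: in_keys_iff\<close>)

lemma poly_eval_single:
  "poly_eval (Poly_Mapping.single m c) y = c * (\<Prod>j\<in>UNIV. (y $ j) ^ Poly_Mapping.lookup m j)"
  by (subst poly_eval_superset[of "{m}"]) auto

lemma poly_eval_0 [simp]: "poly_eval 0 y = 0"
  by (simp add: poly_eval_def)

lemma poly_eval_1 [simp]: "poly_eval 1 y = 1"
  using poly_eval_single[of 0 1 y] by simp

lemma poly_eval_add: "poly_eval (p + q) y = poly_eval p y + poly_eval q y"
proof -
  let ?F = "Poly_Mapping.keys p \<union> Poly_Mapping.keys q"
  have "Poly_Mapping.keys (p + q) \<subseteq> ?F" by (rule keys_add)
  then show ?thesis
    by (simp add: poly_eval_superset[of ?F] lookup_add distrib_right sum.distrib)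
qed

lemma poly_eval_minus: "poly_eval (- p) y = - poly_eval p y"
  using poly_eval_add[of "- p" p y] by (simp add: add_eq_0_iff)

lemma poly_eval_diff: "poly_eval (p - q) y = poly_eval p y - poly_eval q y"
  using poly_eval_add[of p "- q" y] by (simp add: poly_eval_minus)

lemma poly_eval_sum: "poly_eval (sum f I) y = (\<Sum>i\<in>I. poly_eval (f i) y)"
  by (induction I rule: infinite_finite_induct) (simp_all add: poly_eval_add)

lemma poly_eval_mult: "poly_eval (p * q) y = poly_eval p y * poly_eval q y"
proof -
  have single: "poly_eval (Poly_Mapping.single m a * Poly_Mapping.single k c) y
      = poly_eval (Poly_Mapping.single m a) y * poly_eval (Poly_Mapping.single k c) y"
    for m k a c
    by (simp add: mult_single poly_eval_single lookup_add power_add prod.distrib)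
  have "poly_eval (p * q) y = poly_eval
      ((\<Sum>m\<in>Poly_Mapping.keys p. Poly_Mapping.single m (Poly_Mapping.lookup p m)) *
       (\<Sum>m\<in>Poly_Mapping.keys q. Poly_Mapping.single m (Poly_Mapping.lookup q m))) y"
    by (simp flip: sum_monomials)
  also have "\<dots> = poly_eval
      (\<Sum>m\<in>Poly_Mapping.keys p. Poly_Mapping.single m (Poly_Mapping.lookup p m)) y * poly_eval
      (\<Sum>m\<in>Poly_Mapping.keys q. Poly_Mapping.single m (Poly_Mapping.lookup q m)) y"
    unfolding sum_product poly_eval_sum single ..
  finally show ?thesis by (simp flip: sum_monomials)
qed

lemma poly_eval_xvar: "poly_eval (xvar j) y = y $ j"
proof -
  have "(\<Prod>i\<in>UNIV. (y $ i) ^ Poly_Mapping.lookup (Poly_Mapping.single j 1) i)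
      = (\<Prod>i\<in>UNIV. if i = j then y $ j else 1)"
    by (rule prod.cong) (auto simp: lookup_single when_def)
  then show ?thesis by (simp add: xvar_def poly_eval_single)
qed

section \<open>Toric varieties inside the torus\<close>

lemma lookup_sum_single:
  "Poly_Mapping.lookup (\<Sum>j\<in>UNIV. Poly_Mapping.single j (f j)) i = f i"
  for f :: "'n::finite \<Rightarrow> 'a::comm_monoid_add"
  by (simp add: Poly_Mapping.lookup_sum lookup_single when_def)

lemma power_int_sum:
  fixes x :: "'a::field"
  assumes "x \<noteq> 0"
  shows "x powi (\<Sum>i\<in>I. f i) = (\<Prod>i\<in>I. x powi f i)"
  using assms by (induction I rule: infinite_finite_induct) (simp_all add: power_int_add)

lemma prod_power_int: "(\<Prod>i\<in>I. f i) powi n = (\<Prod>i\<in>I. f i powi n)"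
  for f :: "'i \<Rightarrow> 'a::field"
  by (induction I rule: infinite_finite_induct) (simp_all add: power_int_mult_distrib)

lemma sum_mult_diff:
  "(\<Sum>j\<in>I. a j * (u j - q * u' j)) = (\<Sum>j\<in>I. a j * u j) - q * (\<Sum>j\<in>I. a j * u' j)"
  for q :: "'a::comm_ring_1"
  by (simp add: algebra_simps sum_subtractf sum_distrib_left)

text \<open>Dividing by the least positive element leaves a smaller remainder in \<open>S\<close>,
  hence 0. Closure in the form \<open>x - q * y\<close> yields negatives and remainders at
  once.\<close>

lemma int_subgroup_principal:
  fixes S :: "int set"
  assumes "0 \<in> S" and closed: "\<And>x y q. x \<in> S \<Longrightarrow> y \<in> S \<Longrightarrow> x - q * y \<in> S"
  shows "\<exists>m\<in>S. \<forall>s\<in>S. m dvd s"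
proof (cases "S = {0}")
  case False
  then obtain s where s: "s \<in> S" "s \<noteq> 0" using assms(1) by auto
  then have "0 - 1 * s \<in> S" using assms by blast
  then have "- s \<in> S" by simp
  with s have "\<exists>n>0. int n \<in> S"
    using \<open>s \<in> S\<close> by (cases s rule: int_cases3) auto
  then obtain n where n: "n > 0 \<and> int n \<in> S" by blast
  define m where "m = (LEAST n. n > 0 \<and> int n \<in> S)"
  have m: "m > 0" "int m \<in> S"
    unfolding m_def using LeastI[of "\<lambda>n. n > 0 \<and> int n \<in> S", OF n] by blast+
  have least: "m \<le> n" if "n > 0" "int n \<in> S" for n
    unfolding m_def by (rule Least_le) (use that in blast)
  have "int m dvd s" if "s \<in> S" for s
  proof -
    have "s - (s div int m) * int m \<in> S" using that m(2) closed by blast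
    then have "s mod int m \<in> S" by (simp add: minus_div_mult_eq_mod)
    moreover have "0 \<le> s mod int m" "s mod int m < int m" using m(1) by simp_all
    ultimately have "s mod int m = 0"
      using least[of "nat (s mod int m)"] by (cases "s mod int m = 0") auto
    then show ?thesis by (simp add: dvd_eq_mod_eq_0)
  qed
  with m(2) show ?thesis by blast
qed auto

lemma complex_power_int_root:
  fixes w :: complex
  assumes "w \<noteq> 0" "m \<noteq> 0"
  shows "\<exists>t. t \<noteq> 0 \<and> t powi m = w"
proof -
  have "exp (Ln w / of_int m) powi m = w"
    using assms by (simp add: exp_power_int)
  then show ?thesis by (metis exp_not_eq_zero)
qed

text \<open>
  Rows are added one at a time.  The values \<open>a i \<cdot> u\<close>, for \<open>u\<close> orthogonal to the earlier rows,
  form a cyclic group \<open>m\<int>\<close>, and an \<open>m\<close>-th root of \<open>y\<^sup>u\<close> for \<open>u\<close> with \<open>a i \<cdot> u = m\<close> serves as \<open>v i\<close>.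
\<close>

lemma monomial_preimage:
  fixes a :: "'d \<Rightarrow> 'n::finite \<Rightarrow> int" and y :: "'n \<Rightarrow> complex"
  assumes "finite F" and "\<And>j. y j \<noteq> 0"
    and "\<And>u. (\<And>k. k \<in> F \<Longrightarrow> (\<Sum>j\<in>UNIV. a k j * u j) = 0) \<Longrightarrow> (\<Prod>j\<in>UNIV. y j powi u j) = 1"
  shows "\<exists>v. (\<forall>k. v k \<noteq> 0) \<and> (\<forall>j. y j = (\<Prod>k\<in>F. v k powi a k j))"
  using assms
proof (induction F arbitrary: y rule: finite_induct)
  case empty
  \<comment> \<open>Without rows every exponent vector is allowed, in particular the unit vectors,
    so \<open>y\<close> is the all-ones point.\<close>
  have "y j = 1" for j
  proof -
    have "(\<Prod>i\<in>UNIV. y i powi (if i = j then 1 else 0)) = 1"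
      by (rule empty.prems(2)) simp
    also have "(\<Prod>i\<in>UNIV. y i powi (if i = j then 1 else 0)) = (\<Prod>i\<in>UNIV. if i = j then y j else 1)"
      by (rule prod.cong) auto
    finally show ?thesis by simp
  qed
  then show ?case by (intro exI[of _ "\<lambda>_. 1"]) simp
next
  case (insert i F)
  \<comment> \<open>On the lattice \<open>L\<close>, \<open>l\<close> is the pairing with the new
    row and \<open>c\<close> is the character u -> y^u. The goal is to write \<open>c\<close> as a
    power of a single number \<open>t\<close> with exponent \<open>l\<close>.\<close>
  define L where "L = {u :: 'n \<Rightarrow> int. \<forall>k\<in>F. (\<Sum>j\<in>UNIV. a k j * u j) = 0}"
  define l where "l u = (\<Sum>j\<in>UNIV. a i j * u j)" for u :: "'n \<Rightarrow> int"
  define c where "c u = (\<Prod>j\<in>UNIV. y j powi u j)" for u :: "'n \<Rightarrow> int"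
  have l_diff: "l (\<lambda>j. u j - q * u' j) = l u - q * l u'" for u u' q
    unfolding l_def by (rule sum_mult_diff)
  have L_diff: "(\<lambda>j. u j - q * u' j) \<in> L" if "u \<in> L" "u' \<in> L" for u u' q
  proof -
    from that show ?thesis unfolding L_def by (simp only: mem_Collect_eq sum_mult_diff) simp
  qed
  have c_diff: "c (\<lambda>j. u j - q * u' j) = c u / c u' powi q" for u u' q
  proof -
    have "y j powi (u j - q * u' j) = y j powi u j / (y j powi u' j) powi q" for j
      using insert.prems(1) by (simp add: power_int_diff power_int_mult[symmetric] mult.commute)
    then show ?thesis unfolding c_def prod_power_int prod_dividef[symmetric] by simp
  qed
  \<comment> \<open>The hypothesis for \<open>insert i F\<close> says that \<open>c\<close> is
    trivial on the kernel of \<open>l\<close> in \<open>L\<close>, so \<open>c\<close> factors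
    through \<open>l\<close>.\<close>
  have c_ker: "c u = 1" if "u \<in> L" "l u = 0" for u
    using insert.prems(2)[of u] that by (auto simp: c_def L_def l_def)
  have c_nz: "c u \<noteq> 0" for u
    using insert.prems(1) by (simp add: c_def)
  have "\<exists>m\<in>l ` L. \<forall>s\<in>l ` L. m dvd s"
  proof (rule int_subgroup_principal)
    have "l (\<lambda>_. 0) = 0" "(\<lambda>_. 0) \<in> L" by (simp_all add: l_def L_def)
    then show "0 \<in> l ` L" by (metis image_eqI)
    fix r s q assume "r \<in> l ` L" "s \<in> l ` L"
    then obtain u u' where u: "u \<in> L" "u' \<in> L" and "r = l u" "s = l u'" by blast
    then have "r - q * s = l (\<lambda>j. u j - q * u' j)" by (simp only: l_diff)
    then show "r - q * s \<in> l ` L" using L_diff[OF u] by (rule image_eqI)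
  qed
  then obtain u0 where u0: "u0 \<in> L" "\<And>u. u \<in> L \<Longrightarrow> l u0 dvd l u" by blast
  obtain t where t: "t \<noteq> 0" "t powi l u0 = c u0"
  proof (cases "l u0 = 0")
    \<comment> \<open>Now \<open>l\<close> vanishes on all of \<open>L\<close> and
      \<open>c u0 = 1\<close>, so any nonzero \<open>t\<close> would do.\<close>
    case True
    with that[of 1] c_ker[OF u0(1)] show ?thesis by simp
  next
    case False
    with that complex_power_int_root[OF c_nz] show ?thesis by blast
  qed
  have c_L: "c u = t powi l u" if "u \<in> L" for u
  proof -
    obtain q where q: "l u = l u0 * q" using u0(2)[OF \<open>u \<in> L\<close>] by blast
    \<comment> \<open>Subtracting \<open>q\<close> copies of the generator \<open>u0\<close> lands
      in the kernel of \<open>l\<close>, so \<open>c u\<close> is determined by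
      \<open>c u0\<close>.\<close>
    have "c (\<lambda>j. u j - q * u0 j) = 1"
      by (rule c_ker) (use L_diff[OF that u0(1)] q in \<open>simp_all add: l_diff\<close>)
    with c_diff[of u q u0] have "c u = c u0 powi q"
      using c_nz[of u0] by simp
    then show ?thesis by (simp add: q power_int_mult t(2))
  qed
  \<comment> \<open>Removing the contribution of row \<open>i\<close> from \<open>y\<close> makes
    the new character trivial on \<open>L\<close>, which is the hypothesis for \<open>F\<close>
    alone.\<close>
  have "\<exists>v. (\<forall>k. v k \<noteq> 0) \<and> (\<forall>j. y j / t powi a i j = (\<Prod>k\<in>F. v k powi a k j))"
  proof (rule insert.IH)
    show "y j / t powi a i j \<noteq> 0" for j using insert.prems(1) t(1) by simp
    fix u assume "\<And>k. k \<in> F \<Longrightarrow> (\<Sum>j\<in>UNIV. a k j * u j) = 0"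
    then have "u \<in> L" by (simp add: L_def)
    have "(\<Prod>j\<in>UNIV. (y j / t powi a i j) powi u j) = c u / t powi l u"
      using t(1) by (simp add: c_def l_def power_int_divide_distrib prod_dividef power_int_sum
          power_int_mult)
    also have "\<dots> = 1" using c_L[OF \<open>u \<in> L\<close>] t(1) by simp
    finally show "(\<Prod>j\<in>UNIV. (y j / t powi a i j) powi u j) = 1" .
  qed
  then obtain v where v: "\<And>k. v k \<noteq> 0" "\<And>j. y j / t powi a i j = (\<Prod>k\<in>F. v k powi a k j)"
    by blast
  have "y j = (\<Prod>k\<in>insert i F. (v(i := t)) k powi a k j)" for j
  proof -
    have "(\<Prod>k\<in>F. (v(i := t)) k powi a k j) = (\<Prod>k\<in>F. v k powi a k j)"
      by (rule prod.cong) (use insert.hyps in auto)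
    with v(2)[of j] t(1) insert.hyps show ?thesis by (simp add: field_simps)
  qed
  with v(1) t(1) show ?case by (intro exI[of _ "v(i := t)"]) simp
qed

text \<open>If y = v^A, then y^u = v^(A u), which is 1 when A u = 0. Conversely these characters are
  the only obstruction to solving for \<open>v\<close>, because nonzero complex numbers have roots
  of every order; this is \<open>monomial_preimage\<close>.\<close>

lemma monomial_map_iff:
  fixes A :: "int^'n::finite^'d::finite"
  assumes "y \<in> torus"
  shows "y \<in> monomial_map A ` torus \<longleftrightarrow>
    (\<forall>u. (\<forall>k. (\<Sum>j\<in>UNIV. A $ k $ j * u j) = 0) \<longrightarrow> (\<Prod>j\<in>UNIV. (y $ j) powi u j) = 1)"
proof (intro iffI allI impI)
  fix u :: "'n \<Rightarrow> int"
  assume "y \<in> monomial_map A ` torus" and u: "\<forall>k. (\<Sum>j\<in>UNIV. A $ k $ j * u j) = 0"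
  then obtain v where v: "v \<in> torus" and y: "y = monomial_map A v" by blast
  have "(\<Prod>j\<in>UNIV. (y $ j) powi u j) = (\<Prod>j\<in>UNIV. \<Prod>k\<in>UNIV. (v $ k) powi (A $ k $ j * u j))"
    by (simp add: y monomial_map_def prod_power_int power_int_mult)
  also have "\<dots> = (\<Prod>k\<in>UNIV. \<Prod>j\<in>UNIV. (v $ k) powi (A $ k $ j * u j))"
    by (rule prod.swap)
  also have "\<dots> = (\<Prod>k\<in>UNIV. (v $ k) powi (\<Sum>j\<in>UNIV. A $ k $ j * u j))"
    using v by (simp add: torus_def power_int_sum)
  finally show "(\<Prod>j\<in>UNIV. (y $ j) powi u j) = 1" by (simp add: u)
next
  assume *: "\<forall>u. (\<forall>k. (\<Sum>j\<in>UNIV. A $ k $ j * u j) = 0) \<longrightarrow> (\<Prod>j\<in>UNIV. (y $ j) powi u j) = 1"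
  have "\<exists>v. (\<forall>k. v k \<noteq> 0) \<and> (\<forall>j. y $ j = (\<Prod>k\<in>UNIV. v k powi (A $ k $ j)))"
    by (rule monomial_preimage) (use assms * in \<open>auto simp: torus_def\<close>)
  then obtain v where "\<And>k. v k \<noteq> 0" "\<And>j. y $ j = (\<Prod>k\<in>UNIV. v k powi (A $ k $ j))" by blast
  then have "(\<chi> k. v k) \<in> torus" "y = monomial_map A (\<chi> k. v k)"
    by (simp_all add: torus_def monomial_map_def vec_eq_iff)
  then show "y \<in> monomial_map A ` torus" by blast
qed

text \<open>Each condition y^u = 1 from \<open>monomial_map_iff\<close> becomes a polynomial
  equation once negative exponents are cleared, so it passes from the image to its Zariski closure.
  Hence the closure adds points only outside the torus.\<close>

lemma affine_toric_inter_torus: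
  fixes A :: "int^'n::finite^'d::finite"
  shows "affine_toric A \<inter> torus = monomial_map A ` torus"
proof
  show "monomial_map A ` torus \<subseteq> affine_toric A \<inter> torus"
    by (auto simp: affine_toric_def zariski_closure_def torus_def monomial_map_def)
  show "affine_toric A \<inter> torus \<subseteq> monomial_map A ` torus"
  proof
    fix y :: "complex^'n" assume y: "y \<in> affine_toric A \<inter> torus"
    have "(\<Prod>j\<in>UNIV. (y $ j) powi u j) = 1"
      if u: "\<forall>k. (\<Sum>j\<in>UNIV. A $ k $ j * u j) = 0" for u
    proof -
      \<comment> \<open>\<open>nat\<close> truncates at 0, so \<open>m u\<close> and
        \<open>m (\<lambda>j. - u j)\<close> are the positive and negative parts of
        \<open>u\<close>, and \<open>p\<close> is the binomial x^(u+) - x^(u-).\<close>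
      define m where "m f = (\<Sum>j\<in>UNIV. Poly_Mapping.single j (nat (f j)))" for f :: "'n \<Rightarrow> int"
      define p where "p = Poly_Mapping.single (m u) (1::complex) - Poly_Mapping.single (m (\<lambda>j. - u j)) 1"
      have eval: "poly_eval p s = (\<Prod>j\<in>UNIV. (s $ j) ^ nat (u j)) - (\<Prod>j\<in>UNIV. (s $ j) ^ nat (- u j))" for s
        by (simp add: p_def m_def poly_eval_diff poly_eval_single lookup_sum_single)
      have binomial: "poly_eval p s = 0 \<longleftrightarrow> (\<Prod>j\<in>UNIV. (s $ j) powi u j) = 1" if "s \<in> torus" for s
      proof -
        have "(s $ j) powi u j = (s $ j) ^ nat (u j) / (s $ j) ^ nat (- u j)" for j
          by (simp add: power_int_def field_simps)
        then show ?thesis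
          using that unfolding eval by (auto simp: torus_def prod_dividef)
      qed
      have "poly_eval p s = 0" if s: "s \<in> monomial_map A ` torus" for s
      proof -
        have "s \<in> torus" using s by (auto simp: torus_def monomial_map_def)
        with s have "\<forall>u. (\<forall>k. (\<Sum>j\<in>UNIV. A $ k $ j * u j) = 0) \<longrightarrow> (\<Prod>j\<in>UNIV. (s $ j) powi u j) = 1"
          by (simp only: monomial_map_iff)
        from this[rule_format, of u] u show ?thesis by (simp add: binomial[OF \<open>s \<in> torus\<close>])
      qed
      with y have "poly_eval p y = 0" by (auto simp: affine_toric_def zariski_closure_def)
      with binomial y show ?thesis by blast
    qed
    with y show "y \<in> monomial_map A ` torus" by (simp add: monomial_map_iff)
  qed
qed

lemma scaled_toric_inter_torus:
  fixes A :: "int^'n::finite^'d::finite"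
  assumes "\<beta> \<in> torus" "y \<in> torus"
  shows "y \<in> scaled_toric A \<beta> \<longleftrightarrow> (\<chi> j. y $ j / \<beta> $ j) \<in> monomial_map A ` torus"
proof -
  have "y \<in> scaled_toric A \<beta> \<longleftrightarrow> (\<chi> j. y $ j / \<beta> $ j) \<in> affine_toric A"
  proof
    assume "(\<chi> j. y $ j / \<beta> $ j) \<in> affine_toric A"
    moreover have "\<beta> $ j * (y $ j / \<beta> $ j) = y $ j" for j
      using assms(1) by (simp add: torus_def)
    then have "y = (\<chi> j. \<beta> $ j * (\<chi> j. y $ j / \<beta> $ j) $ j)"
      by (simp only: vec_eq_iff vec_lambda_beta) simp
    ultimately show "y \<in> scaled_toric A \<beta>" unfolding scaled_toric_def by (rule rev_image_eqI)
  next
    assume "y \<in> scaled_toric A \<beta>"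
    then obtain z where z: "z \<in> affine_toric A" "y = (\<chi> j. \<beta> $ j * z $ j)"
      unfolding scaled_toric_def by blast
    then have "(\<chi> j. y $ j / \<beta> $ j) = z"
      using assms(1) by (simp add: torus_def vec_eq_iff)
    with z show "(\<chi> j. y $ j / \<beta> $ j) \<in> affine_toric A" by simp
  qed
  moreover have "(\<chi> j. y $ j / \<beta> $ j) \<in> torus" using assms by (simp add: torus_def)
  ultimately show ?thesis using affine_toric_inter_torus[of A] by blast
qed

text \<open>The binomials y^u - \<beta>^u with A u = 0 lie in the Laurent ideal, and by
  \<open>monomial_map_iff\<close> applied to y / \<beta> they already cut out the scaled toric
  variety inside the torus.\<close>

lemma scaled_toric_zero_locus:
  fixes A :: "int^'n::finite^'d::finite"
  assumes "\<beta> \<in> torus" "y \<in> torus"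
    and zero: "\<And>h. h \<in> laurent_ideal (scaled_toric A \<beta> \<inter> torus) \<Longrightarrow> laurent_eval h y = 0"
  shows "y \<in> scaled_toric A \<beta>"
proof -
  have "(\<Prod>j\<in>UNIV. (y $ j / \<beta> $ j) powi u j) = 1"
    if u: "\<forall>k. (\<Sum>j\<in>UNIV. A $ k $ j * u j) = 0" for u
  proof -
    define h where "h = Poly_Mapping.single (\<Sum>j\<in>UNIV. Poly_Mapping.single j (u j)) 1
        - scalar (\<Prod>j\<in>UNIV. (\<beta> $ j) powi u j)"
    have eval: "laurent_eval h s = (\<Prod>j\<in>UNIV. (s $ j) powi u j) - (\<Prod>j\<in>UNIV. (\<beta> $ j) powi u j)" for s
      by (simp add: h_def laurent_eval_diff laurent_eval_single lookup_sum_single)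
    have binomial: "laurent_eval h s = 0 \<longleftrightarrow> (\<Prod>j\<in>UNIV. (s $ j / \<beta> $ j) powi u j) = 1"
      if "s \<in> torus" for s
      using assms(1) that unfolding eval
      by (auto simp: torus_def power_int_divide_distrib prod_dividef)
    have "laurent_eval h s = 0" if s: "s \<in> scaled_toric A \<beta>" "s \<in> torus" for s
    proof -
      have "(\<chi> j. s $ j / \<beta> $ j) \<in> torus" using assms s by (simp add: torus_def)
      from monomial_map_iff[OF this, of A] s u assms(1) show ?thesis
        by (simp add: scaled_toric_inter_torus binomial)
    qed
    then have "laurent_eval h y = 0" by (intro zero) (simp add: laurent_ideal_def)
    with binomial assms(2) show ?thesis by blast
  qed
  moreover have "(\<chi> j. y $ j / \<beta> $ j) \<in> torus" using assms by (simp add: torus_def)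
  ultimately show ?thesis
    by (simp add: scaled_toric_inter_torus[OF assms(1,2)] monomial_map_iff)
qed

section \<open>Lissajous points and torus points of the scaled toric variety\<close>

lemma vector_matrix_mult_rows: "c v* M = (\<Sum>i\<in>UNIV. c $ i *s row i M)"
  by (simp add: vector_matrix_mult_def row_def vec_eq_iff)

lemma span_rows: "vec.span (rows M) = range (\<lambda>c. c v* M)"
  for M :: "'a::field^'n^'m"
proof
  have "row i M = axis i 1 v* M" for i
    by (simp add: vector_matrix_mult_rows axis_def if_distrib[where f = "\<lambda>a. a *s _"] cong: if_cong)
  then have "rows M \<subseteq> range (\<lambda>c. c v* M)" by (auto simp: rows_def)
  moreover have "vec.subspace (range (\<lambda>c. c v* M))"
    unfolding vec.subspace_def
    by (auto simp flip: vector_matrix_left_distrib scalar_vector_matrix_assoc intro: rev_image_eqI[of 0])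
  ultimately show "vec.span (rows M) \<subseteq> range (\<lambda>c. c v* M)"
    by (rule vec.span_minimal)
  show "range (\<lambda>c. c v* M) \<subseteq> vec.span (rows M)"
    unfolding vector_matrix_mult_rows image_subset_iff
    by (intro ballI vec.span_sum vec.span_scale vec.span_base) (auto simp: rows_def)
qed

lemma row_space_iff:
  "w \<in> row_space A \<longleftrightarrow> (\<exists>c. w = (\<chi> j. \<Sum>k\<in>UNIV. c k * of_int (A $ k $ j)))"
proof
  assume "w \<in> row_space A"
  then obtain c where "w = c v* map_matrix complex_of_int A"
    unfolding row_space_def span_rows by blast
  then show "\<exists>c. w = (\<chi> j. \<Sum>k\<in>UNIV. c k * of_int (A $ k $ j))"
    by (intro exI[of _ "\<lambda>k. c $ k"]) (simp add: vector_matrix_mult_def)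
next
  assume "\<exists>c. w = (\<chi> j. \<Sum>k\<in>UNIV. c k * of_int (A $ k $ j))"
  then obtain c where "w = (\<chi> k. c k) v* map_matrix complex_of_int A"
    by (auto simp: vector_matrix_mult_def)
  then show "w \<in> row_space A"
    unfolding row_space_def span_rows by blast
qed

text \<open>For w in the row space and u = w - (pi/2) b, the point y = exp(i u) equals \<beta> exp(i
  w) entrywise, and cos u = (y + 1/y) / 2. As exp maps onto the nonzero complex numbers, y runs over
  exactly the torus points of the scaled toric variety.\<close>

lemma lissajous_iff:
  fixes A :: "int^'n::finite^'d::finite" and b \<beta> x :: "complex^'n"
  assumes \<beta>: "\<beta> = (\<chi> j. exp (- \<i> * b $ j * complex_of_real pi / 2))"
  shows "x \<in> lissajous A b \<longleftrightarrow>
    (\<exists>y\<in>scaled_toric A \<beta> \<inter> torus. \<forall>j. 2 * x $ j = y $ j + inverse (y $ j))"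
proof -
  have \<beta>_torus: "\<beta> \<in> torus" by (simp add: \<beta> torus_def)
  \<comment> \<open>\<open>c\<close> holds the coefficients of the row combination w, so
    \<open>e c\<close> is exp(i u) for the corresponding shifted vector u.\<close>
  define e where "e c = (\<chi> j. \<beta> $ j * exp (\<i> * (\<Sum>k\<in>UNIV. c k * of_int (A $ k $ j))))"
    for c :: "'d \<Rightarrow> complex"
  have e_torus: "e c \<in> torus" for c by (simp add: e_def torus_def \<beta>)
  have scaled: "y \<in> scaled_toric A \<beta> \<longleftrightarrow> (\<exists>c. y = e c)" if "y \<in> torus" for y
  proof -
    have mono: "monomial_map A (\<chi> k. exp (\<i> * c k)) = (\<chi> j. e c $ j / \<beta> $ j)" for c
    proof -
      have "(\<Prod>k\<in>UNIV. exp (\<i> * c k) powi (A $ k $ j)) = exp (\<i> * (\<Sum>k\<in>UNIV. c k * of_int (A $ k $ j)))" for j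
        unfolding exp_power_int sum_distrib_left exp_sum[OF finite]
        by (rule prod.cong) (simp_all only: mult_ac)
      then show ?thesis using \<beta>_torus by (simp add: monomial_map_def e_def torus_def vec_eq_iff)
    qed
    have "(\<chi> j. y $ j / \<beta> $ j) \<in> monomial_map A ` torus \<longleftrightarrow>
        (\<exists>c. (\<chi> j. y $ j / \<beta> $ j) = monomial_map A (\<chi> k. exp (\<i> * c k)))"
    proof
      assume "(\<chi> j. y $ j / \<beta> $ j) \<in> monomial_map A ` torus"
      then obtain v where v: "v \<in> torus" "(\<chi> j. y $ j / \<beta> $ j) = monomial_map A v" by blast
      \<comment> \<open>The coordinates of \<open>v\<close> are nonzero and so have logarithms; the
        exponential therefore parametrises the whole torus.\<close>
      have "v = (\<chi> k. exp (\<i> * (- \<i> * Ln (v $ k))))"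
        using v(1) by (simp add: torus_def vec_eq_iff)
      with v(2) show "\<exists>c. (\<chi> j. y $ j / \<beta> $ j) = monomial_map A (\<chi> k. exp (\<i> * c k))"
        by metis
    next
      assume "\<exists>c. (\<chi> j. y $ j / \<beta> $ j) = monomial_map A (\<chi> k. exp (\<i> * c k))"
      then show "(\<chi> j. y $ j / \<beta> $ j) \<in> monomial_map A ` torus"
        by (auto simp: torus_def)
    qed
    also have "\<dots> \<longleftrightarrow> (\<exists>c. y = e c)"
      unfolding mono using \<beta>_torus by (simp add: torus_def vec_eq_iff)
    finally show ?thesis by (simp only: scaled_toric_inter_torus[OF \<beta>_torus that])
  qed
  have cos: "cos ((\<Sum>k\<in>UNIV. c k * of_int (A $ k $ j)) - complex_of_real pi / 2 * b $ j)
      = (e c $ j + inverse (e c $ j)) / 2" for c j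
  proof -
    have shift: "- \<i> * z * complex_of_real pi / 2 + \<i> * w = \<i> * (w - complex_of_real pi / 2 * z)"
      for w z by (simp add: field_simps)
    have "e c $ j = exp (- \<i> * b $ j * complex_of_real pi / 2 + \<i> * (\<Sum>k\<in>UNIV. c k * of_int (A $ k $ j)))"
      by (simp only: e_def \<beta> vec_lambda_beta exp_add)
    also have "\<dots> = exp (\<i> * ((\<Sum>k\<in>UNIV. c k * of_int (A $ k $ j)) - complex_of_real pi / 2 * b $ j))"
      by (simp only: shift)
    finally show ?thesis by (simp only: cos_exp_eq exp_minus)
  qed
  have "row_space A = range (\<lambda>c. \<chi> j. \<Sum>k\<in>UNIV. c k * of_int (A $ k $ j))"
    by (auto simp: row_space_iff)
  then have "lissajous A b =
      range (\<lambda>c. \<chi> j. cos ((\<Sum>k\<in>UNIV. c k * of_int (A $ k $ j)) - complex_of_real pi / 2 * b $ j))"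
    by (simp add: lissajous_def image_image)
  then have "x \<in> lissajous A b \<longleftrightarrow> (\<exists>c. \<forall>j. x $ j = (e c $ j + inverse (e c $ j)) / 2)"
    by (simp only: image_iff cos vec_eq_iff vec_lambda_beta bex_UNIV)
  also have "\<dots> \<longleftrightarrow> (\<exists>c. \<forall>j. 2 * x $ j = e c $ j + inverse (e c $ j))"
    by (simp add: eq_divide_eq mult.commute)
  also have "\<dots> \<longleftrightarrow> (\<exists>y\<in>scaled_toric A \<beta> \<inter> torus. \<forall>j. 2 * x $ j = y $ j + inverse (y $ j))"
    using scaled e_torus by (metis IntE IntI)
  finally show ?thesis .
qed

section \<open>Rank deficiency and common left eigenvectors\<close>

text \<open>A zero left kernel makes \<open>c v* M\<close> injective in \<open>c\<close>, so the row
  space has full dimension. Conversely a relation with \<open>c $ i\<close> nonzero expresses row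
  \<open>i\<close> through the others, and fewer than \<open>CARD('m)\<close> vectors span the row
  space.\<close>

lemma rank_less_iff:
  fixes M :: "'a::field^'n^'m"
  shows "rank M < CARD('m) \<longleftrightarrow> (\<exists>c. c \<noteq> 0 \<and> c v* M = 0)"
proof
  show "\<exists>c. c \<noteq> 0 \<and> c v* M = 0" if "rank M < CARD('m)"
  proof (rule ccontr)
    assume *: "\<nexists>c. c \<noteq> 0 \<and> c v* M = 0"
    have "inj (\<lambda>c. c v* M)"
    proof (rule injI)
      fix c c' assume "c v* M = c' v* M"
      then have "(c - c') v* M = 0" by (simp add: vector_matrix_mult_diff_distrib)
      with * show "c = c'" by (metis right_minus_eq)
    qed
    moreover have "Vector_Spaces.linear (*s) (*s) (\<lambda>c. c v* M)"
      by unfold_locales (simp_all add: vector_matrix_left_distrib scalar_vector_matrix_assoc)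
    ultimately have "vec.dim (range (\<lambda>c. c v* M)) = vec.dim (UNIV :: ('a^'m) set)"
      by (intro vec.dim_image_eq) simp_all
    then have "rank M = CARD('m)"
      by (simp only: row_rank_def_gen vec_dim_card span_rows[symmetric] vec.dim_span)
    with that show False by simp
  qed
next
  assume "\<exists>c. c \<noteq> 0 \<and> c v* M = 0"
  then obtain c i where c: "c v* M = 0" "c $ i \<noteq> 0" by (auto simp: vec_eq_iff)
  let ?W = "(\<lambda>k. row k M) ` (- {i})"
  have other: "row k M \<in> vec.span ?W" if "k \<noteq> i" for k
    using that by (intro vec.span_base) auto
  have "c $ i *s row i M + (\<Sum>k\<in>- {i}. c $ k *s row k M) = 0"
    using c(1) unfolding vector_matrix_mult_rows
    by (simp add: sum.remove[of UNIV i] Compl_eq_Diff_UNIV)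
  then have "c $ i *s row i M = - (\<Sum>k\<in>- {i}. c $ k *s row k M)"
    by (simp add: eq_neg_iff_add_eq_0)
  moreover have "(\<Sum>k\<in>- {i}. c $ k *s row k M) \<in> vec.span ?W"
    by (intro vec.span_sum vec.span_scale other) simp
  ultimately have "c $ i *s row i M \<in> vec.span ?W"
    by (simp only: vec.span_neg)
  then have "inverse (c $ i) *s (c $ i *s row i M) \<in> vec.span ?W"
    by (rule vec.span_scale)
  then have "row i M \<in> vec.span ?W" using c(2) by simp
  with other have "row k M \<in> vec.span ?W" for k by (cases "k = i") auto
  then have "rows M \<subseteq> vec.span ?W" by (auto simp: rows_def)
  then have "rank M \<le> card ?W"
    unfolding row_rank_def_gen by (rule vec.dim_le_card) simp
  also have "\<dots> \<le> card (- {i})" by (rule card_image_le) simp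
  also have "\<dots> < CARD('m)" by (rule psubset_card_mono) auto
  finally show "rank M < CARD('m)" .
qed

text \<open>
  If \<open>v\<close> is not already an eigenvector of \<open>M i\<close> for \<open>t i\<close>, then \<open>v M\<^sub>i - t\<^sub>i v\<close> is one for \<open>1 / t\<^sub>i\<close>;
  by commutativity it remains an eigenvector of the earlier matrices.
\<close>

lemma common_row_eigenvector:
  fixes M :: "'i \<Rightarrow> 'k::field^'m^'m"
  assumes "finite F" "vec.subspace W" "w \<in> W" "w \<noteq> 0"
    and invariant: "\<And>i v. v \<in> W \<Longrightarrow> v v* M i \<in> W"
    and commute: "\<And>i j. M i ** M j = M j ** M i"
    and quadratic: "\<And>i v. v v* M i v* M i = (t i + inverse (t i)) *s (v v* M i) - v"
    and nonzero: "\<And>i. t i \<noteq> 0"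
  shows "\<exists>v\<in>W. v \<noteq> 0 \<and> (\<forall>i\<in>F. \<exists>s\<in>{t i, inverse (t i)}. v v* M i = s *s v)"
  using assms(1)
proof (induction F rule: finite_induct)
  case empty
  then show ?case using assms by auto
next
  case (insert i F)
  then obtain v where v: "v \<in> W" "v \<noteq> 0"
    "\<And>j. j \<in> F \<Longrightarrow> \<exists>s\<in>{t j, inverse (t j)}. v v* M j = s *s v" by blast
  show ?case
  proof (cases "v v* M i = t i *s v")
    case True
    with v show ?thesis by (intro bexI[of _ v]) auto
  next
    case False
    define v' where "v' = v v* M i - t i *s v"
    have "v' \<in> W"
      unfolding v'_def by (intro vec.subspace_diff vec.subspace_scale invariant v(1) assms(2))
    moreover have "v' \<noteq> 0" using False by (simp add: v'_def)
    \<comment> \<open>The quadratic relation on \<open>M i\<close> factors as (M - t)(M - 1/t) = 0,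
      so the image of M - t is killed by M - 1/t.\<close>
    moreover have "v' v* M i = inverse (t i) *s v'"
      using nonzero[of i]
      by (simp add: v'_def vector_matrix_mult_diff_distrib scalar_vector_matrix_assoc quadratic
          vec_eq_iff algebra_simps)
    moreover have "v' v* M j = s *s v'" if "v v* M j = s *s v" for j s
    proof -
      have "v v* M i v* M j = v v* M j v* M i"
        by (simp add: vector_matrix_mul_assoc commute)
      then show ?thesis using that
        by (simp add: v'_def vector_matrix_mult_diff_distrib scalar_vector_matrix_assoc
            vec_eq_iff algebra_simps)
    qed
    ultimately show ?thesis using v(3) by (intro bexI[of _ v']) (auto, metis)
  qed
qed

section \<open>Multiplication matrices as a representation of the Laurent ring\<close>

lemma extend_scalars_single:
  "extend_scalars (Poly_Mapping.single m c) = Poly_Mapping.single m (of_poly (Poly_Mapping.single 0 c))"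
  unfolding extend_scalars_def
  by (rule poly_mapping_eqI) (simp add: map.rep_eq lookup_single when_def)

lemma extend_scalars_add: "extend_scalars (g + h) = extend_scalars g + extend_scalars h"
  unfolding extend_scalars_def
  by (rule poly_mapping_eqI) (auto simp: map.rep_eq lookup_add when_def single_add of_poly_add
      simp flip: of_poly_add single_add)

lemma extend_scalars_sum: "extend_scalars (sum f I) = (\<Sum>i\<in>I. extend_scalars (f i))"
proof -
  have "extend_scalars (0 :: ('a, complex) laurent) = 0"
    using extend_scalars_add[of "0 :: ('a, complex) laurent" 0] by (simp only: add_0_left add_cancel_right_right)
  then show ?thesis
    by (induction I rule: infinite_finite_induct) (simp_all add: extend_scalars_add)
qed

lemma extend_scalars_mult: "extend_scalars (g * h) = extend_scalars g * extend_scalars h"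
proof -
  have single: "extend_scalars (Poly_Mapping.single m a * Poly_Mapping.single k c)
      = extend_scalars (Poly_Mapping.single m a) * extend_scalars (Poly_Mapping.single k c)"
    for m k :: "'a \<Rightarrow>\<^sub>0 int" and a c
    by (simp add: mult_single extend_scalars_single flip: of_poly_mult)
  have "extend_scalars (g * h) = extend_scalars
      ((\<Sum>m\<in>Poly_Mapping.keys g. Poly_Mapping.single m (Poly_Mapping.lookup g m)) *
       (\<Sum>m\<in>Poly_Mapping.keys h. Poly_Mapping.single m (Poly_Mapping.lookup h m)))"
    by (simp flip: sum_monomials)
  also have "\<dots> = extend_scalars
      (\<Sum>m\<in>Poly_Mapping.keys g. Poly_Mapping.single m (Poly_Mapping.lookup g m)) * extend_scalars
      (\<Sum>m\<in>Poly_Mapping.keys h. Poly_Mapping.single m (Poly_Mapping.lookup h m))"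
    unfolding sum_product extend_scalars_sum single ..
  finally show ?thesis by (simp flip: sum_monomials)
qed

lemma is_mult_matrix_add:
  assumes "is_mult_matrix g M" "is_mult_matrix h N"
  shows "is_mult_matrix (g + h) (M + N)"
  unfolding is_mult_matrix_def
proof
  fix S
  have "(g * basis_mon S - (\<Sum>T\<in>UNIV. scalar (M $ T $ S) * basis_mon T))
      + (h * basis_mon S - (\<Sum>T\<in>UNIV. scalar (N $ T $ S) * basis_mon T)) \<in> rel_ideal"
    using assms unfolding is_mult_matrix_def rel_ideal_def by (blast intro: ring_module.span_add)
  then show "(g + h) * basis_mon S - (\<Sum>T\<in>UNIV. scalar ((M + N) $ T $ S) * basis_mon T) \<in> rel_ideal"
    by (simp add: scalar_hom distrib_right sum.distrib add_diff_add)
qed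

lemma scalar_sum: "scalar (sum f I) = (\<Sum>i\<in>I. scalar (f i))"
  by (induction I rule: infinite_finite_induct) (simp_all add: scalar_hom)

text \<open>Two rewritings modulo the ideal are composed: \<open>h * basis_mon S\<close> is expanded
  in the basis, with an error that stays in the ideal after multiplication by \<open>g\<close>, and
  then each \<open>g * basis_mon U\<close> is expanded.\<close>

lemma is_mult_matrix_mult:
  assumes "is_mult_matrix g M" "is_mult_matrix h N"
  shows "is_mult_matrix (g * h) (M ** N)"
  unfolding is_mult_matrix_def
proof
  fix S
  let ?h = "\<Sum>U\<in>UNIV. scalar (N $ U $ S) * basis_mon U"
  let ?g = "\<lambda>U. \<Sum>T\<in>UNIV. scalar (M $ T $ U) * basis_mon T"
  have "g * (h * basis_mon S - ?h) + (\<Sum>U\<in>UNIV. scalar (N $ U $ S) * (g * basis_mon U - ?g U)) \<in> rel_ideal"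
    using assms unfolding is_mult_matrix_def rel_ideal_def
    by (intro ring_module.span_add ring_module.span_sum ring_module.span_scale) blast+
  moreover have "(\<Sum>T\<in>UNIV. scalar ((M ** N) $ T $ S) * basis_mon T) = (\<Sum>U\<in>UNIV. scalar (N $ U $ S) * ?g U)"
  proof -
    have "(\<Sum>T\<in>UNIV. scalar ((M ** N) $ T $ S) * basis_mon T)
        = (\<Sum>T\<in>UNIV. \<Sum>U\<in>UNIV. scalar (N $ U $ S) * (scalar (M $ T $ U) * basis_mon T))"
      by (simp add: matrix_matrix_mult_def scalar_sum scalar_hom sum_distrib_left sum_distrib_right mult_ac)
    also have "\<dots> = (\<Sum>U\<in>UNIV. \<Sum>T\<in>UNIV. scalar (N $ U $ S) * (scalar (M $ T $ U) * basis_mon T))"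
      by (rule sum.swap)
    finally show ?thesis by (simp only: sum_distrib_left)
  qed
  moreover have "g * ?h = (\<Sum>U\<in>UNIV. scalar (N $ U $ S) * (g * basis_mon U))"
    by (simp add: sum_distrib_left mult_ac)
  ultimately show "g * h * basis_mon S - (\<Sum>T\<in>UNIV. scalar ((M ** N) $ T $ S) * basis_mon T) \<in> rel_ideal"
    by (simp add: right_diff_distrib sum_subtractf mult.assoc)
qed

lemma is_mult_matrix_scalar: "is_mult_matrix (scalar c) (mat c)"
  unfolding is_mult_matrix_def
proof
  fix S :: "'a set"
  have "(\<Sum>T\<in>UNIV. scalar (mat c $ T $ S) * basis_mon T)
      = (\<Sum>T\<in>UNIV. if T = S then scalar c * basis_mon S else 0)"
    by (rule sum.cong) (auto simp: mat_def scalar_hom)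
  then show "scalar c * basis_mon S - (\<Sum>T\<in>UNIV. scalar (mat c $ T $ S) * basis_mon T) \<in> rel_ideal"
    by (simp add: rel_ideal_def ring_module.span_zero)
qed

text \<open>For fixed \<open>x\<close> this is a representation of the complex Laurent ring, which
  reduces the remaining argument to linear algebra over the complex numbers.\<close>

definition mult_matrix_at ::
  "complex^'n::{finite,linorder} \<Rightarrow> ('n, complex) laurent \<Rightarrow> complex^('n set)^('n set)" where
  "mult_matrix_at x g = eval_matrix (mult_matrix_poly g) x"

text \<open>Identities between polynomial matrices can be verified as congruences modulo
  \<open>rel_ideal\<close> over \<open>K\<close>, since multiplication matrices are unique and
  \<open>of_poly\<close> is injective.\<close>

lemma mult_matrix_poly_eqI:
  assumes "is_mult_matrix (extend_scalars g) (map_matrix of_poly N)"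
  shows "mult_matrix_poly g = N"
  by (simp add: mult_matrix_poly_def mult_matrix_eqI[OF assms] vec_eq_iff inj_of_poly)

lemma is_mult_matrix_poly:
  "is_mult_matrix (extend_scalars g) (map_matrix of_poly (mult_matrix_poly g))"
  using mult_matrix_complex by metis

lemma mult_matrix_at_add: "mult_matrix_at x (g + h) = mult_matrix_at x g + mult_matrix_at x h"
proof -
  have "mult_matrix_poly (g + h) = mult_matrix_poly g + mult_matrix_poly h"
  proof (rule mult_matrix_poly_eqI)
    have "map_matrix of_poly (mult_matrix_poly g + mult_matrix_poly h)
        = map_matrix of_poly (mult_matrix_poly g) + map_matrix of_poly (mult_matrix_poly h)"
      by (simp add: vec_eq_iff of_poly_add)
    then show "is_mult_matrix (extend_scalars (g + h)) (map_matrix of_poly (mult_matrix_poly g + mult_matrix_poly h))"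
      by (simp only: extend_scalars_add is_mult_matrix_add is_mult_matrix_poly)
  qed
  then show ?thesis by (simp add: mult_matrix_at_def eval_matrix_def vec_eq_iff poly_eval_add)
qed

lemma mult_matrix_at_mult: "mult_matrix_at x (g * h) = mult_matrix_at x g ** mult_matrix_at x h"
proof -
  have "mult_matrix_poly (g * h) = mult_matrix_poly g ** mult_matrix_poly h"
  proof (rule mult_matrix_poly_eqI)
    have "map_matrix of_poly (mult_matrix_poly g ** mult_matrix_poly h)
        = map_matrix of_poly (mult_matrix_poly g) ** map_matrix of_poly (mult_matrix_poly h)"
      by (simp add: vec_eq_iff matrix_matrix_mult_def of_poly_sum of_poly_mult)
    then show "is_mult_matrix (extend_scalars (g * h)) (map_matrix of_poly (mult_matrix_poly g ** mult_matrix_poly h))"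
      by (simp only: extend_scalars_mult is_mult_matrix_mult is_mult_matrix_poly)
  qed
  then show ?thesis
    by (simp add: mult_matrix_at_def eval_matrix_def vec_eq_iff matrix_matrix_mult_def
        poly_eval_sum poly_eval_mult)
qed

lemma map_matrix_mat: "f 0 = 0 \<Longrightarrow> map_matrix f (mat c) = mat (f c)"
  by (simp add: vec_eq_iff mat_def)

lemma mult_matrix_at_scalar:
  fixes x :: "complex^'n::{finite,linorder}"
  shows "mult_matrix_at x (scalar c) = mat c"
proof -
  have "mult_matrix_poly (scalar c :: ('n, complex) laurent) = mat (Poly_Mapping.single 0 c)"
  proof (rule mult_matrix_poly_eqI)
    show "is_mult_matrix (extend_scalars (scalar c)) (map_matrix of_poly (mat (Poly_Mapping.single 0 c)))"
      unfolding map_matrix_mat[where f = of_poly, OF of_poly_0] extend_scalars_single scalar_def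
      by (rule is_mult_matrix_scalar[unfolded scalar_def])
  qed
  then show ?thesis
    by (simp add: mult_matrix_at_def eval_matrix_def map_matrix_mat poly_eval_single)
qed

lemma mult_matrix_at_yvar:
  fixes j :: "'n::{finite,linorder}"
  shows "mult_matrix_at x (yvar_power j 1) $ T $ S =
    (if T - {j} \<noteq> S - {j} then 0
     else if j \<in> S then (if j \<in> T then 2 * x $ j else - 1)
     else (if j \<in> T then 1 else 0))"
proof -
  have ext: "extend_scalars (yvar_power j 1) = yvar_power j 1"
    by (simp add: yvar_power_def extend_scalars_single)
  have "of_poly (mult_matrix_poly (yvar_power j 1) $ T $ S) = mult_matrix (yvar_power j 1) $ T $ S"
    using mult_matrix_complex(2)[of "yvar_power j 1"] by (simp add: ext vec_eq_iff)
  also have "\<dots> = of_poly (if T - {j} \<noteq> S - {j} then 0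
     else if j \<in> S then (if j \<in> T then 2 * xvar j else - 1)
     else (if j \<in> T then 1 else 0))"
    by (simp only: mult_matrix_yvar of_poly_uminus of_poly_0 of_poly_1 split: if_split) simp
  finally have "mult_matrix_poly (yvar_power j 1) $ T $ S = (if T - {j} \<noteq> S - {j} then 0
     else if j \<in> S then (if j \<in> T then 2 * xvar j else - 1)
     else (if j \<in> T then 1 else 0))"
    by (rule injD[OF inj_of_poly])
  moreover have "poly_eval (2 * xvar j) x = 2 * x $ j"
    unfolding mult_2 poly_eval_add poly_eval_xvar ..
  ultimately show ?thesis
    by (simp add: mult_matrix_at_def eval_matrix_def poly_eval_minus)
qed

text \<open>Column \<open>S\<close> is supported on the rows \<open>insert j S\<close> and
  \<open>S - {j}\<close>. In this form eigenvector equations and the quadratic relation can be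
  checked coordinate by coordinate.\<close>

lemma row_mult_matrix_at_yvar:
  fixes j :: "'n::{finite,linorder}"
  shows "v v* mult_matrix_at x (yvar_power j 1) =
    (\<chi> S. if j \<in> S then 2 * x $ j * v $ S - v $ (S - {j}) else v $ insert j S)"
proof (subst vec_eq_iff, rule allI)
  fix S :: "'n set"
  have *: "T - {j} = S - {j} \<longleftrightarrow> T = insert j S \<or> T = S - {j}" for T by auto
  have "(v v* mult_matrix_at x (yvar_power j 1)) $ S
      = (\<Sum>T\<in>UNIV. v $ T * mult_matrix_at x (yvar_power j 1) $ T $ S)"
    by (simp add: vector_matrix_mult_def)
  also have "\<dots> = (\<Sum>T\<in>{insert j S, S - {j}}. v $ T * mult_matrix_at x (yvar_power j 1) $ T $ S)"
    by (rule sum.mono_neutral_right) (auto simp: mult_matrix_at_yvar *)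
  also have "\<dots> = v $ insert j S * mult_matrix_at x (yvar_power j 1) $ insert j S $ S
      + v $ (S - {j}) * mult_matrix_at x (yvar_power j 1) $ (S - {j}) $ S"
    by (subst sum.insert) auto
  also have "\<dots> = (\<chi> S. if j \<in> S then 2 * x $ j * v $ S - v $ (S - {j}) else v $ insert j S) $ S"
    by (auto simp: mult_matrix_at_yvar insert_absorb)
  finally show "(v v* mult_matrix_at x (yvar_power j 1)) $ S
      = (\<chi> S. if j \<in> S then 2 * x $ j * v $ S - v $ (S - {j}) else v $ insert j S) $ S" .
qed

section \<open>Common zeros and the left kernel\<close>

text \<open>The set of \<open>g\<close> for which this holds is closed under sums and products and
  contains the scalars, the variables and their inverses, hence is the whole Laurent ring.\<close>

lemma row_eigenvector_laurent_eval:
  assumes y: "y \<in> torus"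
    and yvar: "\<And>j. v v* mult_matrix_at x (yvar_power j 1) = y $ j *s v"
  shows "v v* mult_matrix_at x g = laurent_eval g y *s v"
proof -
  define E where "E g \<longleftrightarrow> v v* mult_matrix_at x g = laurent_eval g y *s v" for g
  have add: "E (g + h)" if "E g" "E h" for g h
    using that unfolding E_def
    by (simp add: mult_matrix_at_add vector_matrix_mult_add_rdistrib laurent_eval_add vec.scale_left_distrib)
  have mult: "E (g * h)" if "E g" "E h" for g h
    using that unfolding E_def
    by (simp add: mult_matrix_at_mult laurent_eval_mult[OF y] scalar_vector_matrix_assoc
        flip: vector_matrix_mul_assoc)
  have scalar: "E (scalar c)" for c
    by (simp add: E_def mult_matrix_at_scalar vector_matrix_mult_def mat_def vec_eq_iff
        if_distrib[where f = "\<lambda>a. _ * a"] cong: if_cong)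
  have one: "E 1" using scalar[of 1] by (simp add: scalar_hom)
  have yvar1: "E (yvar_power j 1)" for j by (simp add: E_def yvar)
  have inverse: "E (yvar_power j (- 1))" for j
  proof -
    have "y $ j \<noteq> 0" using y by (simp add: torus_def)
    \<comment> \<open>The matrices of y_j and of its inverse have product 1; applying this product
      to \<open>v\<close> and dividing by the nonzero eigenvalue gives the claim for the
      inverse.\<close>
    have "v = v v* mult_matrix_at x (yvar_power j 1 * yvar_power j (- 1))"
      using one by (simp add: E_def yvar_inverse) (metis laurent_eval_scalar scalar_hom(2) vec.scale_one)
    also have "\<dots> = y $ j *s (v v* mult_matrix_at x (yvar_power j (- 1)))"
      by (simp add: mult_matrix_at_mult yvar scalar_vector_matrix_assoc flip: vector_matrix_mul_assoc)
    finally have "inverse (y $ j) *s v = inverse (y $ j) *s (y $ j *s (v v* mult_matrix_at x (yvar_power j (- 1))))"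
      by simp
    then show ?thesis using \<open>y $ j \<noteq> 0\<close> by (simp add: E_def power_int_minus)
  qed
  have power: "E (yvar_power j k)" for j k
  proof (induction k rule: int_induct[where k = 0])
    case base
    then show ?case by (simp add: yvar_power_0 one)
  next
    case (step1 i)
    from mult[OF step1.IH yvar1] show ?case by (simp only: yvar_power_add)
  next
    case (step2 i)
    from mult[OF step2.IH inverse] show ?case by (simp only: diff_conv_add_uminus yvar_power_add)
  qed
  have prod: "E (\<Prod>j\<in>F. yvar_power j (f j))" for F f
    by (induction F rule: infinite_finite_induct) (simp_all add: one mult power)
  have single: "E (Poly_Mapping.single m c)" for m c
  proof -
    have "Poly_Mapping.single m c = scalar c * Poly_Mapping.single m 1"
      by (simp add: scalar_def mult_single)
    then show ?thesis using mult[OF scalar prod] by (simp only: monomial_eq_prod)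
  qed
  \<comment> \<open>The instance \<open>single[of 0 0, simplified]\<close> supplies
    \<open>E 0\<close>, the value of the empty sum.\<close>
  have "E (\<Sum>m\<in>F. Poly_Mapping.single m (f m))" for F f
    by (induction F rule: infinite_finite_induct) (simp_all add: add single single[of 0 0, simplified])
  then have "E g" by (subst sum_monomials)
  then show ?thesis by (simp add: E_def)
qed

text \<open>The roots of t^2 - 2 x t + 1 are x + r and x - r with r^2 = x^2 - 1; their product is 1,
  so each is the inverse of the other.\<close>

lemma complex_add_inverse_eq: "\<exists>t::complex. t \<noteq> 0 \<and> 2 * x = t + inverse t"
proof -
  define r where "r = csqrt (x\<^sup>2 - 1)"
  have "(x + r) * (x - r) = 1"
    using power2_csqrt[of "x\<^sup>2 - 1"] by (simp add: r_def algebra_simps power2_eq_square)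
  then have "x + r \<noteq> 0" "inverse (x + r) = x - r" by (auto simp: inverse_unique)
  then show ?thesis by (intro exI[of _ "x + r"]) simp
qed

lemma common_zero_iff_row_kernel:
  fixes g :: "'r::finite \<Rightarrow> ('n::{finite,linorder}, complex) laurent"
  shows "(\<exists>y\<in>torus. (\<forall>j. 2 * x $ j = y $ j + inverse (y $ j)) \<and> (\<forall>k. laurent_eval (g k) y = 0))
    \<longleftrightarrow> (\<exists>v. v \<noteq> 0 \<and> (\<forall>k. v v* mult_matrix_at x (g k) = 0))"
proof
  assume "\<exists>y\<in>torus. (\<forall>j. 2 * x $ j = y $ j + inverse (y $ j)) \<and> (\<forall>k. laurent_eval (g k) y = 0)"
  then obtain y where y: "y \<in> torus" "\<And>j. 2 * x $ j = y $ j + inverse (y $ j)"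
    "\<And>k. laurent_eval (g k) y = 0" by blast
  define v where "v = (\<chi> S. \<Prod>j\<in>S. y $ j)"
  have "v v* mult_matrix_at x (yvar_power j 1) = y $ j *s v" for j
  proof (subst vec_eq_iff, rule allI)
    fix S
    have nz: "y $ j \<noteq> 0" using y(1) by (simp add: torus_def)
    show "(v v* mult_matrix_at x (yvar_power j 1)) $ S = (y $ j *s v) $ S"
    proof (cases "j \<in> S")
      case True
      then have "(\<Prod>i\<in>S. y $ i) = y $ j * (\<Prod>i\<in>S - {j}. y $ i)" by (simp add: prod.remove)
      \<comment> \<open>This is 2 x_j y_j - 1 = y_j^2 multiplied by \<open>p\<close>, which stands
        for the entry of \<open>v\<close> at \<open>S - {j}\<close>.\<close>
      moreover have "(y $ j + inverse (y $ j)) * (y $ j * p) - p = y $ j * (y $ j * p)" for p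
        using nz by (simp add: distrib_right mult.assoc[symmetric])
      ultimately show ?thesis
        using True by (simp add: row_mult_matrix_at_yvar v_def y(2))
    qed (simp add: row_mult_matrix_at_yvar v_def)
  qed
  then have "v v* mult_matrix_at x (g k) = 0" for k
    by (simp add: row_eigenvector_laurent_eval[OF y(1)] y(3))
  moreover have "v $ {} = 1" by (simp add: v_def)
  then have "v \<noteq> 0" by auto
  ultimately show "\<exists>v. v \<noteq> 0 \<and> (\<forall>k. v v* mult_matrix_at x (g k) = 0)" by blast
next
  assume "\<exists>v. v \<noteq> 0 \<and> (\<forall>k. v v* mult_matrix_at x (g k) = 0)"
  then obtain w where w: "w \<noteq> 0" "\<And>k. w v* mult_matrix_at x (g k) = 0" by blast
  define W where "W = {v. \<forall>k. v v* mult_matrix_at x (g k) = 0}"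
  have "\<forall>j. \<exists>t. t \<noteq> 0 \<and> 2 * x $ j = t + inverse t"
    using complex_add_inverse_eq by blast
  then obtain t where "\<forall>j. t j \<noteq> 0 \<and> 2 * x $ j = t j + inverse (t j)"
    by (rule choice[THEN exE])
  then have t: "\<And>j. t j \<noteq> 0" "\<And>j. 2 * x $ j = t j + inverse (t j)" by blast+
  have commute: "mult_matrix_at x f ** mult_matrix_at x h = mult_matrix_at x h ** mult_matrix_at x f" for f h
    by (simp add: mult.commute flip: mult_matrix_at_mult)
  have "\<exists>v\<in>W. v \<noteq> 0 \<and> (\<forall>j\<in>UNIV. \<exists>s\<in>{t j, inverse (t j)}. v v* mult_matrix_at x (yvar_power j 1) = s *s v)"
  proof (rule common_row_eigenvector)
    show "vec.subspace W"
      by (simp add: W_def vec.subspace_def vector_matrix_left_distrib scalar_vector_matrix_assoc)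
    show "w \<in> W" using w by (simp add: W_def)
    show "v v* mult_matrix_at x (yvar_power j 1) \<in> W" if "v \<in> W" for j v
    proof -
      have "v v* mult_matrix_at x (yvar_power j 1) v* mult_matrix_at x (g k)
          = v v* mult_matrix_at x (g k) v* mult_matrix_at x (yvar_power j 1)" for k
        by (simp add: vector_matrix_mul_assoc commute)
      with that show ?thesis by (simp add: W_def)
    qed
    show "v v* mult_matrix_at x (yvar_power j 1) v* mult_matrix_at x (yvar_power j 1)
        = (t j + inverse (t j)) *s (v v* mult_matrix_at x (yvar_power j 1)) - v" for j v
      by (auto simp: row_mult_matrix_at_yvar vec_eq_iff insert_absorb simp flip: t(2))
  qed (use w t commute in auto)
  then obtain v where v: "v \<in> W" "v \<noteq> 0"
    "\<forall>j. \<exists>s\<in>{t j, inverse (t j)}. v v* mult_matrix_at x (yvar_power j 1) = s *s v" by blast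
  then obtain s where s: "\<And>j. s j \<in> {t j, inverse (t j)}"
    "\<And>j. v v* mult_matrix_at x (yvar_power j 1) = s j *s v" by metis
  define y where "y = (\<chi> j. s j)"
  \<comment> \<open>Exchanging \<open>t j\<close> and its inverse leaves their sum unchanged, so
    either eigenvalue gives a point above \<open>x\<close>.\<close>
  have s_inverse: "s j \<noteq> 0 \<and> 2 * x $ j = s j + inverse (s j)" for j
    using s(1)[of j] t[of j] by auto
  then have y: "y \<in> torus" "\<And>j. 2 * x $ j = y $ j + inverse (y $ j)"
    by (simp_all add: y_def torus_def)
  \<comment> \<open>Membership of \<open>v\<close> in \<open>W\<close> forces its eigenvalue under
    the matrix of \<open>g k\<close> to vanish.\<close>
  have "laurent_eval (g k) y *s v = 0" for k
    using row_eigenvector_laurent_eval[OF y(1), of v x "g k"] s(2) v(1) by (simp add: W_def y_def)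
  with v(2) have "laurent_eval (g k) y = 0" for k by (metis vec.scale_eq_0_iff)
  with y show "\<exists>y\<in>torus. (\<forall>j. 2 * x $ j = y $ j + inverse (y $ j)) \<and> (\<forall>k. laurent_eval (g k) y = 0)"
    by blast
qed

text \<open>Evaluation at a torus point is multiplicative, so vanishing at \<open>y\<close> passes
  from the generators to the whole ideal, and \<open>scaled_toric_zero_locus\<close> recovers the
  variety from that ideal.\<close>

lemma scaled_toric_iff_generators:
  fixes A :: "int^'n::{finite,linorder}^'d::finite"
  assumes "\<beta> \<in> torus" "y \<in> torus"
    and gen: "ideal_generated_by (Set.range g) = laurent_ideal (scaled_toric A \<beta> \<inter> torus)"
  shows "y \<in> scaled_toric A \<beta> \<longleftrightarrow> (\<forall>k. laurent_eval (g k) y = 0)"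
proof
  assume "y \<in> scaled_toric A \<beta>"
  moreover have "g k \<in> laurent_ideal (scaled_toric A \<beta> \<inter> torus)" for k
    unfolding gen[symmetric] by (rule ring_module.span_base) simp
  ultimately show "\<forall>k. laurent_eval (g k) y = 0" using assms(2) by (auto simp: laurent_ideal_def)
next
  assume *: "\<forall>k. laurent_eval (g k) y = 0"
  have "ring_module.subspace {h. laurent_eval h y = 0}"
    by (auto simp: ring_module.subspace_def laurent_eval_add laurent_eval_mult assms(2))
  then have "ideal_generated_by (Set.range g) \<subseteq> {h. laurent_eval h y = 0}"
    by (rule ring_module.span_minimal[rotated]) (use * in auto)
  then show "y \<in> scaled_toric A \<beta>"
    unfolding gen by (intro scaled_toric_zero_locus[OF assms(1,2)]) blast
qed

theorem theorem3p1:
  fixes A :: "int^'n::{finite,linorder}^'d::finite"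
    and b \<beta> :: "complex^'n::{finite,linorder}"
    and g :: "'r::finite \<Rightarrow> ('n, complex) laurent"
  assumes \<beta>: "\<beta> = (\<chi> j. exp (- \<i> * b $ j * complex_of_real pi / 2))"
    and gen: "ideal_generated_by (Set.range g) = laurent_ideal (scaled_toric A \<beta> \<inter> torus)"
  shows "lissajous A b =
    {x. rank (eval_matrix (concat_matrices (\<lambda>k. mult_matrix_poly (g k))) x) < 2 ^ CARD('n)}"
proof (rule Set.set_eqI)
  fix x
  have "\<beta> \<in> torus" by (simp add: \<beta> torus_def)
  then have "x \<in> lissajous A b \<longleftrightarrow>
      (\<exists>y\<in>torus. (\<forall>j. 2 * x $ j = y $ j + inverse (y $ j)) \<and> (\<forall>k. laurent_eval (g k) y = 0))"
    using scaled_toric_iff_generators[OF _ _ gen] unfolding lissajous_iff[OF \<beta>] by blast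
  also have "\<dots> \<longleftrightarrow> (\<exists>v. v \<noteq> 0 \<and> (\<forall>k. v v* mult_matrix_at x (g k) = 0))"
    by (rule common_zero_iff_row_kernel)
  \<comment> \<open>A row vector kills the concatenation exactly when it kills every block.\<close>
  also have "\<dots> \<longleftrightarrow>
      (\<exists>v. v \<noteq> 0 \<and> v v* eval_matrix (concat_matrices (\<lambda>k. mult_matrix_poly (g k))) x = 0)"
    by (simp add: vec_eq_iff vector_matrix_mult_def mult_matrix_at_def eval_matrix_def
        concat_matrices_def split_paired_all)
  \<comment> \<open>The matrix rows are indexed by subsets of the variables, so
    \<open>CARD('n set)\<close> is the bound 2^n.\<close>
  also have "\<dots> \<longleftrightarrow>
      rank (eval_matrix (concat_matrices (\<lambda>k. mult_matrix_poly (g k))) x) < CARD('n set)"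
    by (rule rank_less_iff[symmetric])
  finally show "x \<in> lissajous A b \<longleftrightarrow>
      x \<in> {x. rank (eval_matrix (concat_matrices (\<lambda>k. mult_matrix_poly (g k))) x) < 2 ^ CARD('n)}"
    by simp
qed

end
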